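(* Let $0<\beta<\infty$ and $n\ge1$. Choose Verblunsky coefficients $\alpha_0,\ldots,\alpha_{n-1}$ to be independent, with $\alpha_k$ distributed in $\mathbb{D}=\{z\in\mathbb{C}:|z|<1\}$ with density $$\frac{\beta(k+1)}{2\pi}(1-|\alpha_k|^2)^{\frac{\beta}{2}(k+1)-1}\,d^2\alpha_k,\qquad 0\le k\le n-1.$$ Then the eigenvalues $z_1,\ldots,z_n$ of the CMV matrix $\mathcal{C}(\alpha_0,\ldots,\alpha_{n-1})$ are distributed in $\mathbb{D}^n$ with the joint law $$\frac{\beta^n}{(2\pi)^n}\prod_{j,k=1}^n(1-z_j\bar z_k)^{\frac{\beta}{2}-1}\prod_{j<k}|z_k-z_j|^2\,d^2z_1\cdots d^2z_n.$$
   Context: $d^2z$ is two-dimensional Lebesgue measure. The joint law of the eigenvalues is the symmetric one: the unordered collection of eigenvalues has the same law as the unordered collection of $n$ points with the stated density on $\mathbb{D}^n$. Powers are principal. CMV matrix: given $\alpha_0,\ldots,\alpha_{n-2}\in\mathbb{D}$ and $\alpha_{n-1}\in\overline{\mathbb{D}}$, let $\rho_k=\sqrt{1-|\alpha_k|^2}$, $\Xi_k=\begin{bmatrix}\bar\alpha_k&\rho_k\\\rho_k&-\alpha_k\end{bmatrix}$ for $0\le k\le n-2$, $\Xi_{-1}=[1]$, $\Xi_{n-1}=[\bar\alpha_{n-1}]$ ($1\times1$ blocks). With the $n\times n$ block-diagonal matrices $\mathcal{L}=\operatorname{diag}(\Xi_0,\Xi_2,\Xi_4,\ldots)$ and $\mathcal{M}=\operatorname{diag}(\Xi_{-1},\Xi_1,\Xi_3,\ldots)$,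 set $\mathcal{C}(\alpha_0,\ldots,\alpha_{n-1})=\mathcal{L}\mathcal{M}$. *)

theory Defs
  imports
    "HOL-Probability.Probability"
    "HOL-Computational_Algebra.Computational_Algebra"
    "Jordan_Normal_Form.Char_Poly"
begin

section \<open>CMV matrices\<close>

text \<open>
  The block with index \<open>n - 1\<close> is the one-by-one block; all lower indices carry two-by-two blocks.
  The block with index \<open>-1\<close> is the leading identity in the second factor below. Since the index is a
  natural number, \<open>Suc k = n\<close> stands for \<open>k = n - 1\<close>.
\<close>

definition cmv_block :: "nat \<Rightarrow> (nat \<Rightarrow> complex) \<Rightarrow> nat \<Rightarrow> complex mat" where
  "cmv_block n \<alpha> k =
    (if Suc k = n then mat_of_rows_list 1 [[cnj (\<alpha> k)]]
     else (let \<rho> = complex_of_real (sqrt (1 - (cmod (\<alpha> k))\<^sup>2))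
           in mat_of_rows_list 2 [[cnj (\<alpha> k), \<rho>], [\<rho>, - \<alpha> k]]))"

definition cmv_L :: "nat \<Rightarrow> (nat \<Rightarrow> complex) \<Rightarrow> complex mat" where
  "cmv_L n \<alpha> = diag_block_mat (map (cmv_block n \<alpha>) (filter even [0..<n]))"

definition cmv_M :: "nat \<Rightarrow> (nat \<Rightarrow> complex) \<Rightarrow> complex mat" where
  "cmv_M n \<alpha> = diag_block_mat (1\<^sub>m 1 # map (cmv_block n \<alpha>) (filter odd [0..<n]))"

definition cmv_matrix :: "nat \<Rightarrow> (nat \<Rightarrow> complex) \<Rightarrow> complex mat" where
  "cmv_matrix n \<alpha> = cmv_L n \<alpha> * cmv_M n \<alpha>"

lemma dim_cmv_block:
  "dim_row (cmv_block n \<alpha> k) = (if Suc k = n then 1 else 2)"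
  "dim_col (cmv_block n \<alpha> k) = (if Suc k = n then 1 else 2)"
  by (simp_all add: cmv_block_def mat_of_rows_list_def Let_def)

lemma cmv_L_M_carrier:
  assumes "n \<ge> 1"
  shows "cmv_L n \<alpha> \<in> carrier_mat n n" "cmv_M n \<alpha> \<in> carrier_mat n n"
proof -
  obtain m where n: "n = Suc m" using assms by (cases n) auto
  have ev: "sum_list (map (\<lambda>k. if Suc k = n then 1 else 2) (filter even [0..<l]))
              = (if even l then l else Suc l)" if "l \<le> m" for l
    using that by (induction l) (auto simp: n)
  have od: "Suc (sum_list (map (\<lambda>k. if Suc k = n then 1 else 2) (filter odd [0..<l])))
              = (if even l then Suc l else l)" if "l \<le> m" for l
    using that by (induction l) (auto simp: n)
  show "cmv_L n \<alpha> \<in> carrier_mat n n" "cmv_M n \<alpha> \<in> carrier_mat n n"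
    using ev[of m] od[of m]
    unfolding cmv_L_def cmv_M_def carrier_mat_def
    by (auto simp: dim_diag_block_mat dim_cmv_block comp_def n split: if_splits simp del: diag_block_mat.simps)
qed

lemma cmv_matrix_carrier:
  assumes "n \<ge> 1"
  shows "cmv_matrix n \<alpha> \<in> carrier_mat n n"
  unfolding cmv_matrix_def using cmv_L_M_carrier[OF assms] by (rule mult_carrier_mat)

section \<open>Eigenvalues and unordered collections of points\<close>

text \<open>Eigenvalues are counted with algebraic multiplicity.\<close>

definition eigenvalue_mset :: "complex mat \<Rightarrow> complex multiset" where
  "eigenvalue_mset A = proots (char_poly A)"

definition unordered :: "nat \<Rightarrow> (nat \<Rightarrow> complex) \<Rightarrow> complex multiset" where
  "unordered n z = image_mset z (mset_set {..<n})"

text \<open>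
  Unordered collections of \<open>n\<close> complex numbers, that is \<open>\<complex>\<^sup>n\<close> modulo permutations, with the quotient
  (finest) \<open>\<sigma>\<close>-algebra: its events correspond to the symmetric Borel subsets of \<open>\<complex>\<^sup>n\<close>.
  As always for \<^const>\<open>sigma\<close>, the measure itself is irrelevant; only space and events are used.
\<close>

definition unordered_events :: "nat \<Rightarrow> complex multiset set set" where
  "unordered_events n =
    {A. A \<subseteq> {X. size X = n} \<and>
        unordered n -` A \<inter> space (PiM {..<n} (\<lambda>_. lborel)) \<in> sets (PiM {..<n} (\<lambda>_. lborel))}"

definition unordered_space :: "nat \<Rightarrow> complex multiset measure" where
  "unordered_space n = sigma {X. size X = n} (unordered_events n)"

lemma size_unordered [simp]: "size (unordered n z) = n"
  by (simp add: unordered_def)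

lemma space_unordered_space [simp]: "space (unordered_space n) = {X. size X = n}"
  by (auto simp: unordered_space_def unordered_events_def intro!: space_measure_of)

lemma sigma_algebra_unordered_events:
  "sigma_algebra {X. size X = n} (unordered_events n)"
proof -
  let ?P = "PiM {..<n} (\<lambda>_. lborel :: complex measure)"
  let ?g = "\<lambda>A. unordered n -` A \<inter> space ?P"
  have 1: "{} \<in> unordered_events n"
    by (simp add: unordered_events_def)
  have 2: "{X. size X = n} - A \<in> unordered_events n" if "A \<in> unordered_events n" for A
  proof -
    have "?g ({X. size X = n} - A) = space ?P - ?g A"
      by auto
    with that show ?thesis
      by (auto simp: unordered_events_def)
  qed
  have 3: "(\<Union>i. A i) \<in> unordered_events n"
    if "range A \<subseteq> unordered_events n" for A :: "nat \<Rightarrow> _"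
  proof -
    have "?g (\<Union>i. A i) = (\<Union>i. ?g (A i))"
      by auto
    moreover have A: "?g (A i) \<in> sets ?P" "A i \<subseteq> {X. size X = n}" for i
      using that by (auto simp: unordered_events_def)
    moreover have "(\<Union>i. ?g (A i)) \<in> sets ?P"
      using A(1) by (intro sets.countable_UN) blast
    ultimately show ?thesis
      unfolding unordered_events_def mem_Collect_eq by (metis UN_least)
  qed
  show ?thesis
    unfolding sigma_algebra_iff2 using 1 2 3 by (auto simp: unordered_events_def)
qed

lemma sets_unordered_space: "sets (unordered_space n) = unordered_events n"
  using sigma_algebra.sets_measure_of_eq[OF sigma_algebra_unordered_events]
  by (simp add: unordered_space_def)

lemma measurable_unordered:
  "unordered n \<in> measurable (PiM {..<n} (\<lambda>_. lborel)) (unordered_space n)"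
  by (rule measurableI) (auto simp: sets_unordered_space unordered_events_def)

section \<open>The densities\<close>

definition verblunsky_density :: "real \<Rightarrow> nat \<Rightarrow> complex \<Rightarrow> ennreal" where
  "verblunsky_density \<beta> k a =
    ennreal (\<beta> * real (k + 1) / (2 * pi) * (1 - (cmod a)\<^sup>2) powr (\<beta> / 2 * real (k + 1) - 1))
      * indicator (ball 0 1) a"

text \<open>
  The factors with \<open>j \<noteq> k\<close> are principal powers of complex numbers. They occur in conjugate
  pairs, so the product is a nonnegative real number, as recorded below.
\<close>

definition interaction :: "real \<Rightarrow> nat \<Rightarrow> (nat \<Rightarrow> complex) \<Rightarrow> complex" where
  "interaction \<beta> n z =
    (\<Prod>j<n. \<Prod>k<n. (1 - z j * cnj (z k)) powr complex_of_real (\<beta> / 2 - 1))"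

definition eigenvalue_density :: "real \<Rightarrow> nat \<Rightarrow> (nat \<Rightarrow> complex) \<Rightarrow> ennreal" where
  "eigenvalue_density \<beta> n z =
    ennreal (\<beta> ^ n / (2 * pi) ^ n * Re (interaction \<beta> n z) *
             (\<Prod>k<n. \<Prod>j<k. (cmod (z k - z j))\<^sup>2))
      * indicator (PiE {..<n} (\<lambda>_. ball 0 1)) z"

lemma interaction_nonneg_real:
  assumes "\<And>j. j < n \<Longrightarrow> z j \<in> ball 0 1"
  shows "interaction \<beta> n z \<in> \<real>\<^sub>\<ge>\<^sub>0"
proof -
  define t where "t j k = (1 - z j * cnj (z k)) powr complex_of_real (\<beta> / 2 - 1)" for j k
  have Re_pos: "Re (1 - z j * cnj (z k)) > 0" if "j < n" "k < n" for j k
  proof -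
    have "cmod (z j * cnj (z k)) < 1"
      using assms[OF that(1)] assms[OF that(2)] mult_strict_mono'[of "cmod (z j)" 1 "cmod (z k)" 1]
      by (simp add: norm_mult)
    with complex_Re_le_cmod[of "z j * cnj (z k)"] show ?thesis
      by simp
  qed
  have sym: "t k j = cnj (t j k)" if "j < n" "k < n" for j k
  proof -
    have "1 - z j * cnj (z k) \<notin> \<real>\<^sub>\<le>\<^sub>0"
      using Re_pos[OF that] complex_nonpos_Reals_iff by fastforce
    thus ?thesis
      using cnj_powr[of "1 - z j * cnj (z k)" "complex_of_real (\<beta> / 2 - 1)"] Re_pos[OF that]
      by (auto simp: t_def mult.commute)
  qed
  have diag: "t j j \<in> \<real>\<^sub>\<ge>\<^sub>0" if "j < n" for j
  proof -
    have eq: "1 - z j * cnj (z j) = complex_of_real (1 - (cmod (z j))\<^sup>2)"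
      by (simp only: complex_norm_square [symmetric] of_real_diff of_real_1)
    have nn: "1 - (cmod (z j))\<^sup>2 \<ge> 0"
      using assms[OF that] by (simp add: power_le_one)
    show ?thesis
      unfolding t_def eq using powr_of_real[OF nn, of "\<beta> / 2 - 1"] by (metis nonneg_Reals_of_real_iff powr_ge_zero)
  qed
  have "(\<Prod>j<m. \<Prod>k<m. t j k) \<in> \<real>\<^sub>\<ge>\<^sub>0" if "m \<le> n" for m
    using that
  proof (induction m)
    case (Suc m)
    define X where "X = (\<Prod>j<m. t j m)"
    have "(\<Prod>k<m. t m k) = cnj X"
      unfolding X_def cnj_prod using Suc.prems by (intro prod.cong) (auto intro: sym)
    hence "(\<Prod>j<Suc m. \<Prod>k<Suc m. t j k) = (\<Prod>j<m. \<Prod>k<m. t j k) * (X * cnj X) * t m m"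
      by (simp add: prod.distrib X_def)
    moreover have "X * cnj X \<in> \<real>\<^sub>\<ge>\<^sub>0"
      by (metis complex_norm_square nonneg_Reals_of_real_iff zero_le_power2)
    moreover have "(\<Prod>j<m. \<Prod>k<m. t j k) \<in> \<real>\<^sub>\<ge>\<^sub>0" "t m m \<in> \<real>\<^sub>\<ge>\<^sub>0"
      using Suc diag[of m] by simp_all
    ultimately show ?case
      by (simp only: nonneg_Reals_mult_I)
  qed auto
  thus ?thesis
    by (simp add: interaction_def t_def)
qed

end

theory Submission
  imports Defs "HOL-Complex_Analysis.Complex_Analysis"
begin

text \<open>
  The characteristic polynomial of the CMV matrix is the last one of the Szego polynomials
  \<open>\<Phi>\<^sub>0 = 1\<close>, \<open>\<Phi>\<^sub>k\<^sub>+\<^sub>1 = X \<Phi>\<^sub>k - cnj \<alpha>\<^sub>k \<Phi>\<^sub>k\<^sup>*\<close> (\<open>char_poly_cmv_matrix\<close>), so only the roots of a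
  random polynomial have to be understood. Both sides of the theorem are compared on the space of
  coefficients of monic polynomials of degree \<open>n\<close>: one volume form is carried there by the Szego
  recursion, another one by the factorization into roots.

  From the Verblunsky side, one step of the recursion with \<open>\<bar>\<alpha>\<^sub>k\<bar> < 1\<close> is a real-linear map from the old
  coefficients to the new ones of positive degree, with Jacobian \<open>(1 - \<bar>\<alpha>\<^sub>k\<bar>\<^sup>2)\<^sup>k\<close>, and the new constant coefficient is
  \<open>- cnj \<alpha>\<^sub>k\<close>. A step preserves, in both directions, the property that all roots lie in the disc
  (\<open>stable_szego_step\<close>), because \<open>\<bar>\<Phi>\<^sup>*\<bar> \<le> \<bar>\<Phi>\<bar>\<close> outside the disc for such \<open>\<Phi>\<close>. Moreover
  \<open>V(\<Phi>) = \<Prod> \<bar>1 - z\<^sub>j cnj z\<^sub>k\<bar>\<close>, the product over all pairs of roots, is the modulus of the resultant of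
  \<open>\<Phi>\<close> and \<open>\<Phi>\<^sup>*\<close>, and the recursion multiplies it by \<open>(1 - \<bar>\<alpha>\<^sub>k\<bar>\<^sup>2)\<^sup>k\<^sup>+\<^sup>1\<close> (\<open>schur_resultant_szego_step\<close>).
  Since \<open>(\<beta>/2)(k + 1) - 1 = (k + 1)(\<beta>/2 - 1) + k\<close>, the density of the coefficients with respect
  to Lebesgue measure is a constant multiple of \<open>V(\<Phi>)\<close> to the power \<open>\<beta>/2 - 1\<close>, restricted to the
  polynomials with all roots in the disc (\<open>nn_integral_szego\<close>).

  From the side of the roots, the map from \<open>n\<close> points to the coefficients is generically \<open>n!\<close>-to-one and has
  real Jacobian \<open>\<Prod>\<^sub>j\<^sub><\<^sub>k \<bar>z\<^sub>k - z\<^sub>j\<bar>\<^sup>2\<close> (\<open>nn_integral_vieta\<close>). This is reduced to complex dimension one by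
  adding one root at a time: with the other coefficients kept fixed in suitable coordinates, the constant
  coefficient is a polynomial function of the new root, and a polynomial \<open>p\<close> of degree \<open>d\<close> covers
  the plane \<open>d\<close> times with Jacobian \<open>\<bar>p'\<bar>\<^sup>2\<close> (\<open>nn_integral_poly\<close>).

  Every change of variables in dimension \<open>n\<close> is a composition of substitutions of one complex coordinate.
  Finally, an event for unordered collections is an event for the coefficients, because the
  roots can be chosen as Borel functions of the coefficients (\<open>measurable_factorization\<close>).
\<close>

section \<open>Change of variables in the complex plane\<close>

text \<open>
  These two maps transport the change of variables theorem from \<open>real ^ 2\<close> to the complex
  plane.
\<close>

definition pair_of_complex :: "complex \<Rightarrow> real ^ 2" where
  "pair_of_complex z = vector [Re z, Im z]"

definition complex_of_pair :: "real ^ 2 \<Rightarrow> complex" where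
  "complex_of_pair v = Complex (vec_nth v 1) (vec_nth v 2)"

lemma pair_of_complex_inverse [simp]:
  "complex_of_pair (pair_of_complex z) = z" "pair_of_complex (complex_of_pair v) = v"
  by (auto simp: pair_of_complex_def complex_of_pair_def Finite_Cartesian_Product.vec_eq_iff forall_2)

lemma bounded_linear_pair_of_complex: "bounded_linear pair_of_complex"
  unfolding linear_conv_bounded_linear [symmetric]
  by (rule linearI) (auto simp: pair_of_complex_def Finite_Cartesian_Product.vec_eq_iff forall_2)

lemma bounded_linear_complex_of_pair: "bounded_linear complex_of_pair"
  unfolding linear_conv_bounded_linear [symmetric]
  by (rule linearI) (auto simp: complex_of_pair_def complex_eq_iff)

lemma measurable_complex_pair [measurable]:
  "pair_of_complex \<in> borel_measurable borel" "complex_of_pair \<in> borel_measurable borel"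
  using bounded_linear_pair_of_complex bounded_linear_complex_of_pair
  by (auto intro!: borel_measurable_continuous_onI linear_continuous_on)

lemma lborel_complex_of_pair: "distr lborel borel complex_of_pair = lborel"
proof (rule lborel_eqI[symmetric])
  fix l u :: complex
  assume le: "\<And>b. b \<in> Basis \<Longrightarrow> l \<bullet> b \<le> u \<bullet> b"
  have Basis2: "(Basis :: (real^2) set) = {axis 1 1, axis 2 1}"
    by (auto simp: Basis_vec_def UNIV_2)
  have ne: "axis 1 1 \<noteq> (axis 2 1 :: real^2)"
    by (auto simp: axis_eq_axis)
  have "complex_of_pair -` box l u = box (pair_of_complex l) (pair_of_complex u)"
    by (auto simp: box_def complex_of_pair_def pair_of_complex_def Basis_complex_def Basis2 inner_axis
             split: if_splits)
  then have "emeasure (distr lborel borel complex_of_pair) (box l u)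
        = emeasure lborel (box (pair_of_complex l) (pair_of_complex u))"
    by (simp add: emeasure_distr)
  also have "\<dots> = (\<Prod>b\<in>Basis. (pair_of_complex u - pair_of_complex l) \<bullet> b)"
    using le[of 1] le[of \<i>] by (intro emeasure_lborel_box)
      (auto simp: pair_of_complex_def Basis_complex_def Basis2 inner_axis)
  also have "\<dots> = (\<Prod>b\<in>Basis. (u - l) \<bullet> b)"
    using ne by (simp add: Basis2 Basis_complex_def pair_of_complex_def inner_axis)
  finally show "emeasure (distr lborel borel complex_of_pair) (box l u) = (\<Prod>b\<in>Basis. (u - l) \<bullet> b)" .
qed simp

lemma nn_integral_complex_of_pair:
  assumes [measurable]: "f \<in> borel_measurable borel"
  shows "(\<integral>\<^sup>+v. f (complex_of_pair v) \<partial>lborel) = (\<integral>\<^sup>+z. f z \<partial>lborel)"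
  by (subst lborel_complex_of_pair[symmetric], subst nn_integral_distr) auto

text \<open>
  Here \<open>J\<close> is the determinant of the real derivative in the basis \<open>1\<close>,
  \<open>\<i>\<close>. Both sides may be infinite: integrability of \<open>J\<close> on
  \<open>A\<close> is equivalent to finite measure of the image.
\<close>

lemma emeasure_image_complex:
  fixes g :: "complex \<Rightarrow> complex" and g' :: "complex \<Rightarrow> complex \<Rightarrow> complex"
  defines "J \<equiv> (\<lambda>x. \<bar>Re (g' x 1) * Im (g' x \<i>) - Re (g' x \<i>) * Im (g' x 1)\<bar>)"
  assumes A [measurable]: "A \<in> sets borel" and gA [measurable]: "g ` A \<in> sets borel"
    and der: "\<And>x. x \<in> A \<Longrightarrow> (g has_derivative g' x) (at x within A)"
    and inj: "inj_on g A"
    and J [measurable]: "J \<in> borel_measurable borel"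
  shows "emeasure lborel (g ` A) = (\<integral>\<^sup>+x. ennreal (J x) * indicator A x \<partial>lborel)"
proof -
  let ?p = pair_of_complex and ?c = complex_of_pair
  define S where "S = ?c -` A"
  define G where "G = (\<lambda>v. ?p (g (?c v)))"
  define G' where "G' = (\<lambda>v h. ?p (g' (?c v) (?c h)))"
  have S_borel [measurable]: "S \<in> sets borel"
    unfolding S_def by (rule measurable_sets_borel[OF measurable_complex_pair(2)]) simp
  then have S_leb: "S \<in> sets lebesgue" by auto
  have cS: "?c ` S = A"
    unfolding S_def by (metis pair_of_complex_inverse(1) surj_def surj_image_vimage_eq)
  have GS: "G ` S = ?c -` (g ` A)"
    unfolding cS[symmetric] G_def by (auto simp: image_iff) (metis pair_of_complex_inverse(2))
  have GS_borel [measurable]: "G ` S \<in> sets borel"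
    unfolding GS by (rule measurable_sets_borel[OF measurable_complex_pair(2)]) simp
  have derG: "(G has_derivative G' v) (at v within S)" if "v \<in> S" for v
  proof -
    have "(g has_derivative g' (?c v)) (at (?c v) within ?c ` S)"
      unfolding cS using der that by (simp add: S_def)
    then have "((\<lambda>v. g (?c v)) has_derivative (\<lambda>h. g' (?c v) (?c h))) (at v within S)"
      by (rule has_derivative_in_compose[OF bounded_linear_imp_has_derivative[OF bounded_linear_complex_of_pair]])
    then show ?thesis
      unfolding G_def G'_def by (rule bounded_linear.has_derivative[OF bounded_linear_pair_of_complex])
  qed
  have injG: "inj_on G S"
    using inj unfolding inj_on_def G_def S_def by (auto) (metis pair_of_complex_inverse)
  have det: "\<bar>Determinants.det (matrix (G' v))\<bar> = J (?c v)" for v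
  proof -
    have "?c (axis 1 1) = 1" "?c (axis 2 1) = \<i>"
      by (auto simp: complex_of_pair_def axis_def complex_eq_iff)
    then show ?thesis
      by (simp add: det_2 matrix_def G'_def J_def pair_of_complex_def mult.commute)
  qed
  note cov = has_measure_differentiable_image[OF S_leb derG injG, unfolded det]
  have int_eq: "(\<integral>\<^sup>+x. ennreal (J x) * indicator A x \<partial>lborel)
      = (\<integral>\<^sup>+v. ennreal (J (?c v)) * indicator S v \<partial>lborel)" (is "?I = ?IS")
    by (subst nn_integral_complex_of_pair[symmetric]) (auto simp: S_def indicator_def intro!: nn_integral_cong)
  have em_eq: "emeasure lborel (g ` A) = emeasure lborel (G ` S)"
  proof -
    have "emeasure lborel (g ` A) = emeasure (distr lborel borel ?c) (g ` A)"
      by (simp add: lborel_complex_of_pair)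
    also have "\<dots> = emeasure lborel (G ` S)"
      by (subst emeasure_distr) (auto simp: GS)
    finally show ?thesis .
  qed
  have Jc: "(\<lambda>v. J (?c v)) \<in> borel_measurable borel" by measurable
  have J0: "J x \<ge> 0" for x by (simp add: J_def)
  have ind_eq: "(\<lambda>v. indicator S v * J (?c v)) = (\<lambda>v. if v \<in> S then J (?c v) else 0)"
    by (auto simp: indicator_def)
  show ?thesis
  proof (cases "?IS < \<infinity>")
    case True
    define m where "m = enn2real ?IS"
    have m: "?IS = ennreal m" "m \<ge> 0" using True by (auto simp: m_def)
    have "?IS = (\<integral>\<^sup>+v. ennreal (indicator S v * J (?c v)) \<partial>lborel)"
      by (intro nn_integral_cong) (auto simp: indicator_def)
    then have "((\<lambda>v. indicator S v * J (?c v)) has_integral m) UNIV"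
      using m J0 by (intro nn_integral_has_integral[where r=m]) (auto simp: Jc)
    then have "((\<lambda>v. J (?c v)) has_integral m) S"
      unfolding ind_eq has_integral_restrict_UNIV .
    then have "G ` S \<in> lmeasurable" "measure lebesgue (G ` S) = m"
      using cov by auto
    then have "emeasure lebesgue (G ` S) = ennreal m"
      by (simp add: emeasure_eq_measure2)
    then show ?thesis
      using int_eq em_eq m by simp
  next
    case False
    have "emeasure lborel (G ` S) = \<infinity>"
    proof (rule ccontr)
      assume "\<not> ?thesis"
      then have "G ` S \<in> lmeasurable"
        by (intro fmeasurableI) (auto simp: less_top)
      then obtain m where m: "((\<lambda>v. J (?c v)) has_integral m) S"
        using cov by auto
      then have "((\<lambda>v. indicator S v * J (?c v)) has_integral m) UNIV"
        unfolding ind_eq has_integral_restrict_UNIV .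
      then have "(\<integral>\<^sup>+v. ennreal (indicator S v * J (?c v)) \<partial>lborel) = ennreal m"
        using J0 by (intro nn_integral_has_integral_lborel) auto
      also have "(\<integral>\<^sup>+v. ennreal (indicator S v * J (?c v)) \<partial>lborel) = ?IS"
        by (intro nn_integral_cong) (auto simp: indicator_def)
      finally show False using False by simp
    qed
    moreover have "?IS = \<infinity>" using False by (simp flip: less_top)
    ultimately show ?thesis using int_eq em_eq by simp
  qed
qed

text \<open>
  The measurable left inverse \<open>h\<close> makes images of Borel subsets of \<open>S\<close>
  Borel, so the substitution can be checked as an equality of two Borel measures.
\<close>

lemma nn_integral_substitution_complex:
  fixes g :: "complex \<Rightarrow> complex" and g' :: "complex \<Rightarrow> complex \<Rightarrow> complex"
  defines "J \<equiv> (\<lambda>x. \<bar>Re (g' x 1) * Im (g' x \<i>) - Re (g' x \<i>) * Im (g' x 1)\<bar>)"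
  assumes S [measurable]: "S \<in> sets borel" and gS [measurable]: "g ` S \<in> sets borel"
    and g [measurable]: "g \<in> borel_measurable borel"
    and h [measurable]: "h \<in> borel_measurable borel" and hg: "\<And>x. x \<in> S \<Longrightarrow> h (g x) = x"
    and der: "\<And>x. x \<in> S \<Longrightarrow> (g has_derivative g' x) (at x within S)"
    and J [measurable]: "J \<in> borel_measurable borel"
    and F [measurable]: "F \<in> borel_measurable borel"
  shows "(\<integral>\<^sup>+x. F (g x) * ennreal (J x) * indicator S x \<partial>lborel) = (\<integral>\<^sup>+y. F y * indicator (g ` S) y \<partial>lborel)"
proof -
  let ?\<mu> = "distr (density lborel (\<lambda>x. ennreal (J x) * indicator S x)) borel g"
  let ?\<nu> = "density lborel (indicator (g ` S) :: complex \<Rightarrow> ennreal)"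
  have "?\<mu> = ?\<nu>"
  proof (rule measure_eqI)
    fix B assume "B \<in> sets ?\<mu>"
    then have B [measurable]: "B \<in> sets borel" by simp
    have 1: "g ` (S \<inter> g -` B) = g ` S \<inter> B" by auto
    have [measurable]: "g -` B \<in> sets borel"
      using measurable_sets_borel[OF g B] .
    have inj: "inj_on g (S \<inter> g -` B)"
      using hg by (metis inj_on_inverseI inj_on_Int)
    have "emeasure ?\<mu> B = (\<integral>\<^sup>+x. ennreal (J x) * indicator S x * indicator (g -` B) x \<partial>lborel)"
      by (subst emeasure_distr) (auto simp: emeasure_density)
    also have "\<dots> = (\<integral>\<^sup>+x. ennreal (J x) * indicator (S \<inter> g -` B) x \<partial>lborel)"
      by (intro nn_integral_cong) (auto simp: indicator_def)
    also have "\<dots> = emeasure lborel (g ` (S \<inter> g -` B))"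
      unfolding J_def using J[unfolded J_def] inj
      by (intro emeasure_image_complex[symmetric])
         (auto intro!: has_derivative_subset[OF der] simp: 1)
    also have "\<dots> = emeasure ?\<nu> B"
      unfolding 1 by (subst emeasure_density)
        (auto simp: indicator_inter_arith[symmetric] nn_integral_indicator intro!: nn_integral_cong)
    finally show "emeasure ?\<mu> B = emeasure ?\<nu> B" .
  qed auto
  then have "(\<integral>\<^sup>+y. F y \<partial>?\<mu>) = (\<integral>\<^sup>+y. F y \<partial>?\<nu>)" by simp
  then show ?thesis
    by (simp add: nn_integral_distr nn_integral_density mult_ac)
qed

lemma borel_measurable_poly [measurable]: "poly q \<in> borel_measurable borel" for q :: "complex poly"
  by (intro borel_measurable_continuous_onI continuous_intros)

lemma borel_measurable_cnj: "cnj \<in> borel_measurable borel"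
  by (intro borel_measurable_continuous_onI continuous_intros)

text \<open>
  For a holomorphic map the real Jacobian is the squared modulus of the derivative, and the inverse on
  an open set of injectivity is again holomorphic, hence measurable.
\<close>

lemma nn_integral_poly_injective:
  fixes p :: "complex poly"
  assumes U: "open U" and inj: "inj_on (poly p) U" and S: "S \<in> sets borel" "S \<subseteq> U"
    and F: "F \<in> borel_measurable borel"
  shows "poly p ` S \<in> sets borel"
    and "(\<integral>\<^sup>+w. F (poly p w) * ennreal ((cmod (poly (pderiv p) w))\<^sup>2) * indicator S w \<partial>lborel)
        = (\<integral>\<^sup>+y. F y * indicator (poly p ` S) y \<partial>lborel)"
proof -
  have hol: "poly p holomorphic_on U" by (intro holomorphic_intros)
  obtain h where h: "h holomorphic_on (poly p ` U)" "\<And>z. z \<in> U \<Longrightarrow> h (poly p z) = z"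
    using holomorphic_has_inverse[OF hol U inj] by metis
  have opU: "open (poly p ` U)" by (rule open_mapping_thm3[OF hol U inj])
  define h' where "h' y = (if y \<in> poly p ` U then h y else 0)" for y
  have h'_meas [measurable]: "h' \<in> borel_measurable borel"
    unfolding h'_def using opU h
    by (intro borel_measurable_continuous_on_if) (auto intro: holomorphic_on_imp_continuous_on)
  have "poly p ` S = poly p ` U \<inter> h' -` S"
    using S h by (auto simp: h'_def)
  moreover have "h' -` S \<in> sets borel"
    using measurable_sets_borel[OF h'_meas S(1)] .
  ultimately show pS: "poly p ` S \<in> sets borel"
    using opU by auto
  have jac: "\<bar>Re (a * 1) * Im (a * \<i>) - Re (a * \<i>) * Im (a * 1)\<bar> = (cmod a)\<^sup>2" for a :: complex
    by (simp add: cmod_power2 flip: power2_eq_square)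
  have "(\<integral>\<^sup>+w. F (poly p w) * ennreal \<bar>Re (poly (pderiv p) w * 1) * Im (poly (pderiv p) w * \<i>)
            - Re (poly (pderiv p) w * \<i>) * Im (poly (pderiv p) w * 1)\<bar> * indicator S w \<partial>lborel)
        = (\<integral>\<^sup>+y. F y * indicator (poly p ` S) y \<partial>lborel)"
  proof (rule nn_integral_substitution_complex[where h = h'])
    show "(poly p has_derivative (\<lambda>h. poly (pderiv p) x * h)) (at x within S)" for x
      using poly_DERIV[of p x] by (auto simp: has_field_derivative_def intro: has_derivative_at_withinI)
    show "h' (poly p x) = x" if "x \<in> S" for x
      using that S h by (auto simp: h'_def)
  qed (use S pS F in \<open>simp_all only: jac borel_measurable_poly h'_meas, measurable\<close>)
  then show "(\<integral>\<^sup>+w. F (poly p w) * ennreal ((cmod (poly (pderiv p) w))\<^sup>2) * indicator S w \<partial>lborel)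
        = (\<integral>\<^sup>+y. F y * indicator (poly p ` S) y \<partial>lborel)"
    by (simp only: jac)
qed

lemma card_roots_rsquarefree:
  fixes p :: "complex poly"
  assumes "rsquarefree p"
  shows "card {w. poly p w = 0} = degree p"
proof -
  have p0: "p \<noteq> 0" using assms by (auto simp: rsquarefree_def)
  have "degree p = degree (Polynomial.smult (lead_coeff p) (\<Prod>z|poly p z = 0. [:-z, 1:]))"
    using complex_poly_decompose_rsquarefree[OF assms] by simp
  also have "\<dots> = (\<Sum>z|poly p z = 0. degree [:-z, 1:])"
    using p0 by (simp add: degree_prod_sum_eq del: degree_pCons_eq)
  finally show ?thesis by simp
qed

text \<open>
  Away from the finitely many critical points the polynomial is locally injective. A countable Borel
  partition into sets of injectivity reduces the claim to counting: a value that is not critical has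
  exactly \<open>degree p\<close> preimages.
\<close>

lemma nn_integral_poly:
  fixes p :: "complex poly"
  assumes deg: "degree p > 0" and F [measurable]: "F \<in> borel_measurable borel"
  shows "(\<integral>\<^sup>+w. F (poly p w) * ennreal ((cmod (poly (pderiv p) w))\<^sup>2) \<partial>lborel)
        = of_nat (degree p) * (\<integral>\<^sup>+y. F y \<partial>lborel)"
proof -
  \<comment> \<open>The critical points; the Jacobian vanishes there, so they do not contribute to the left-hand side.\<close>
  define C where "C = {w. poly (pderiv p) w = 0}"
  have finC: "finite C"
    unfolding C_def using deg by (intro poly_roots_finite) (auto simp: pderiv_eq_0_iff)
  have C_open: "open (- C)" using finC by (simp add: finite_imp_closed open_Compl)
  have hol: "poly p holomorphic_on - C" by (intro holomorphic_intros)
  have "\<exists>r>0. ball w r \<subseteq> - C \<and> inj_on (poly p) (ball w r)" if "w \<in> - C" for w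
  proof -
    have "deriv (poly p) w \<noteq> 0"
      using that DERIV_imp_deriv[OF poly_DERIV[of p w]] by (simp add: C_def)
    then show ?thesis
      using has_complex_derivative_locally_injective[of "poly p" "- C" w] that C_open
        hol by blast
  qed
  then obtain r where r: "\<And>w. w \<in> - C \<Longrightarrow> r w > 0 \<and> ball w (r w) \<subseteq> - C \<and> inj_on (poly p) (ball w (r w))"
    by metis
  define \<F> where "\<F> = (\<lambda>w. ball w (r w)) ` (- C)"
  have UF: "\<Union>\<F> = - C"
    unfolding \<F>_def using r by fastforce
  obtain \<F>' where F': "\<F>' \<subseteq> \<F>" "countable \<F>'" "\<Union>\<F>' = \<Union>\<F>"
    using Lindelof[of \<F>] by (auto simp: \<F>_def)
  have "\<F>' \<noteq> {}"
    using F' UF finC by (metis Compl_empty_eq Union_empty double_compl infinite_UNIV_char_0)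
  then obtain B :: "nat \<Rightarrow> complex set" where B: "range B = \<F>'"
    using F'(2) uncountable_def by blast
  have Bi: "open (B i)" "inj_on (poly p) (B i)" for i
  proof -
    have "B i \<in> \<F>" using B F'(1) by blast
    then show "open (B i)" "inj_on (poly p) (B i)"
      using r by (auto simp: \<F>_def)
  qed
  define D where "D = disjointed B"
  have UD: "(\<Union>i. D i) = - C"
    using B F'(3) UF by (simp add: D_def UN_disjointed_eq)
  have disj: "disjoint_family D" by (simp add: D_def disjoint_family_disjointed)
  have DB: "D i \<subseteq> B i" for i by (simp add: D_def disjointed_subset)
  have D_meas [measurable]: "D i \<in> sets borel" for i
    using sets.range_disjointed_sets[of B borel] Bi(1) by (auto simp: D_def image_subset_iff)
  have pD_meas [measurable]: "poly p ` D i \<in> sets borel" for i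
    by (rule nn_integral_poly_injective(1)[OF Bi _ DB F]) auto
  define J where "J w = ennreal ((cmod (poly (pderiv p) w))\<^sup>2)" for w
  have [measurable]: "J \<in> borel_measurable borel" unfolding J_def by measurable
  have "(\<integral>\<^sup>+w. F (poly p w) * J w \<partial>lborel)
      = (\<integral>\<^sup>+w. (\<Sum>i. F (poly p w) * J w * indicator (D i) w) \<partial>lborel)"
  proof (intro nn_integral_cong)
    fix w :: complex
    have "J w = 0" if "w \<in> C" using that by (simp add: C_def J_def)
    then show "F (poly p w) * J w = (\<Sum>i. F (poly p w) * J w * indicator (D i) w)"
      using suminf_indicator[OF disj, of w] UD by (cases "w \<in> C") auto
  qed
  also have "\<dots> = (\<Sum>i. \<integral>\<^sup>+w. F (poly p w) * J w * indicator (D i) w \<partial>lborel)"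
    by (rule nn_integral_suminf) measurable
  also have "\<dots> = (\<Sum>i. \<integral>\<^sup>+y. F y * indicator (poly p ` D i) y \<partial>lborel)"
    unfolding J_def by (intro suminf_cong nn_integral_poly_injective(2)[OF Bi _ DB F]) auto
  also have "\<dots> = (\<integral>\<^sup>+y. (\<Sum>i. F y * indicator (poly p ` D i) y) \<partial>lborel)"
    by (rule nn_integral_suminf[symmetric]) measurable
  also have "\<dots> = (\<integral>\<^sup>+y. of_nat (degree p) * F y \<partial>lborel)"
  proof (rule nn_integral_cong_AE)
    have "AE y in lborel. y \<notin> poly p ` C"
      using finC by (intro AE_not_in finite_imp_null_set_lborel) auto
    then show "AE y in lborel. (\<Sum>i. F y * indicator (poly p ` D i) y) = of_nat (degree p) * F y"
    proof eventually_elim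
      case (elim y)
      define R where "R = {w. poly p w = y}"
      have R': "R = {w. poly (p - [:y:]) w = 0}" by (auto simp: R_def)
      have deg': "degree (p - [:y:]) = degree p"
        using deg by (subst diff_conv_add_uminus, subst degree_add_eq_left) auto
      have finR: "finite R"
        unfolding R' using deg deg' by (intro poly_roots_finite) auto
      have RC: "R \<subseteq> - C" using elim by (auto simp: R_def)
      have "rsquarefree (p - [:y:])"
        using RC by (auto simp: rsquarefree_roots pderiv_diff R_def C_def pderiv_pCons)
      then have cardR: "card R = degree p"
        unfolding R' using card_roots_rsquarefree deg' by metis
      have ind: "indicator (poly p ` D i) y = (\<Sum>w\<in>R. indicator (D i) w :: ennreal)" for i
      proof (cases "y \<in> poly p ` D i")
        case True
        then obtain w where w: "w \<in> D i" "poly p w = y" by auto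
        have "(\<Sum>v\<in>R. indicator (D i) v :: ennreal) = (\<Sum>v\<in>{w}. indicator (D i) v)"
          using finR w Bi(2)[of i] DB[of i]
          by (intro sum.mono_neutral_right) (auto simp: R_def inj_on_def indicator_def)
        then show ?thesis using w by auto
      next
        case False
        then have "(\<Sum>v\<in>R. indicator (D i) v :: ennreal) = 0"
          by (intro sum.neutral) (auto simp: R_def indicator_def)
        with False show ?thesis by simp
      qed
      have "(\<Sum>i. F y * indicator (poly p ` D i) y) = F y * (\<Sum>i. \<Sum>w\<in>R. indicator (D i) w)"
        unfolding ind by simp
      also have "(\<Sum>i. \<Sum>w\<in>R. indicator (D i) w :: ennreal) = (\<Sum>w\<in>R. \<Sum>i. indicator (D i) w)"
        by (rule suminf_sum) simp
      also have "\<dots> = (\<Sum>w\<in>R. 1)"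
        using RC by (intro sum.cong refl) (auto simp: suminf_indicator[OF disj] UD)
      finally show ?case using cardR by (simp add: mult.commute)
    qed
  qed
  also have "\<dots> = of_nat (degree p) * (\<integral>\<^sup>+y. F y \<partial>lborel)"
    by (rule nn_integral_cmult) measurable
  finally show ?thesis by (simp add: J_def)
qed

text \<open>
  This real-linear map has determinant \<open>1 - \<bar>a\<bar>\<^sup>2\<close>, and its inverse is
  \<open>y \<mapsto> (y + a * cnj y) / (1 - \<bar>a\<bar>\<^sup>2)\<close>.
\<close>

lemma nn_integral_conj_affine:
  fixes a :: complex
  assumes a: "cmod a < 1" and F [measurable]: "F \<in> borel_measurable borel"
  shows "(\<integral>\<^sup>+y. F (y - a * cnj y) \<partial>lborel) * ennreal (1 - (cmod a)\<^sup>2) = (\<integral>\<^sup>+y. F y \<partial>lborel)"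
proof -
  define d where "d = 1 - (cmod a)\<^sup>2"
  have d: "d > 0" using a by (simp add: d_def power_less_one_iff abs_square_less_1)
  define g where "g y = y - a * cnj y" for y
  define h where "h y = (y + a * cnj y) / complex_of_real d" for y
  have gc: "continuous_on UNIV g" "continuous_on UNIV h"
    using d unfolding g_def h_def by (auto intro!: continuous_intros)
  note [measurable] = borel_measurable_continuous_onI[OF gc(1)] borel_measurable_continuous_onI[OF gc(2)]
  have dd: "complex_of_real d = 1 - a * cnj a"
    by (simp add: d_def flip: complex_norm_square)
  have hg: "h (g x) = x" for x
  proof -
    have "x - a * cnj x + a * cnj (x - a * cnj x) = x * complex_of_real d"
      unfolding dd by (simp add: algebra_simps)
    then show ?thesis using d by (simp add: h_def g_def)
  qed
  have gh: "g (h y) = y" for y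
  proof -
    have "y + a * cnj y - a * cnj (y + a * cnj y) = y * complex_of_real d"
      unfolding dd by (simp add: algebra_simps)
    then show ?thesis using d by (simp add: h_def g_def flip: diff_divide_distrib)
  qed
  have gU: "g ` UNIV = UNIV" using gh by (metis surjI)
  have jac: "\<bar>Re (g 1) * Im (g \<i>) - Re (g \<i>) * Im (g 1)\<bar> = d"
    using d unfolding g_def d_def cmod_power2 by (simp add: power2_eq_square algebra_simps)
  have "(\<integral>\<^sup>+x. F (g x) * ennreal \<bar>Re (g 1) * Im (g \<i>) - Re (g \<i>) * Im (g 1)\<bar> * indicator UNIV x \<partial>lborel)
      = (\<integral>\<^sup>+y. F y * indicator (g ` UNIV) y \<partial>lborel)"
  proof (rule nn_integral_substitution_complex[where h = h])
    have "bounded_linear g"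
      unfolding g_def by (intro bounded_linear_sub bounded_linear_ident
          bounded_linear_compose[OF bounded_linear_mult_right bounded_linear_cnj])
    then show "(g has_derivative g) (at x within UNIV)" for x
      by (rule bounded_linear_imp_has_derivative)
  qed (use hg gU in auto)
  also have "(\<integral>\<^sup>+x. F (g x) * ennreal \<bar>Re (g 1) * Im (g \<i>) - Re (g \<i>) * Im (g 1)\<bar> * indicator UNIV x \<partial>lborel)
      = (\<integral>\<^sup>+y. F (g y) \<partial>lborel) * ennreal d"
    unfolding jac by (subst nn_integral_multc[symmetric]) auto
  finally show ?thesis
    unfolding gU by (simp add: g_def d_def)
qed

section \<open>Monic polynomials and their coefficients\<close>

abbreviation lborel_pi :: "nat \<Rightarrow> (nat \<Rightarrow> complex) measure" where
  "lborel_pi n \<equiv> PiM {..<n} (\<lambda>_. lborel)"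

interpretation lborel_product: product_sigma_finite "\<lambda>_. lborel :: complex measure"
  by unfold_locales

lemma measurable_coordinate: "i < n \<Longrightarrow> (\<lambda>x. x i) \<in> borel_measurable (lborel_pi n)"
  using measurable_component_singleton[of i "{..<n}" "\<lambda>_. lborel"] by simp

lemma measurable_fst_coordinate:
  "i < n \<Longrightarrow> (\<lambda>x. fst x i) \<in> borel_measurable (lborel_pi n \<Otimes>\<^sub>M lborel)"
  using measurable_compose[OF measurable_fst measurable_coordinate] by simp

text \<open>
  The coefficient \<open>c i\<close> belongs to \<open>X ^ (n - 1 - i)\<close>. In this reversed
  numbering a new constant coefficient is appended as coordinate \<open>n\<close>, so raising the
  degree never renumbers the old coordinates of the product measure.
\<close>

primrec monic_poly :: "nat \<Rightarrow> (nat \<Rightarrow> complex) \<Rightarrow> complex poly" where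
  "monic_poly 0 c = 1"
| "monic_poly (Suc n) c = pCons (c n) (monic_poly n c)"

lemma monic_poly_monic: "degree (monic_poly n c) = n" "coeff (monic_poly n c) n = 1"
proof -
  have "degree (monic_poly n c) = n \<and> coeff (monic_poly n c) n = 1"
    by (induction n) auto
  then show "degree (monic_poly n c) = n" "coeff (monic_poly n c) n = 1" by auto
qed

lemma monic_poly_nonzero [simp]: "monic_poly n c \<noteq> 0"
  using monic_poly_monic(2)[of n c] by force

lemma monic_poly_cong: "(\<And>i. i < n \<Longrightarrow> c i = d i) \<Longrightarrow> monic_poly n c = monic_poly n d"
  by (induction n) auto

lemma monic_poly_restrict [simp]: "n \<le> m \<Longrightarrow> monic_poly n (restrict c {..<m}) = monic_poly n c"
  by (rule monic_poly_cong) auto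

lemma monic_poly_upd [simp]: "monic_poly n (c(n := u)) = monic_poly n c"
  by (rule monic_poly_cong) auto

definition coeffs_of :: "nat \<Rightarrow> complex poly \<Rightarrow> nat \<Rightarrow> complex" where
  "coeffs_of n p = (\<lambda>i\<in>{..<n}. coeff p (n - 1 - i))"

lemma monic_poly_coeffs_of:
  assumes "degree p = n" "coeff p n = 1"
  shows "monic_poly n (coeffs_of n p) = p"
  using assms
proof (induction n arbitrary: p)
  case 0
  then show ?case by (auto elim!: degree_eq_zeroE simp: one_pCons)
next
  case (Suc n)
  obtain a q where p: "p = pCons a q" by (cases p)
  have q: "degree q = n" "coeff q n = 1" using Suc.prems by (auto simp: p split: if_splits)
  have "monic_poly n (coeffs_of (Suc n) p) = monic_poly n (coeffs_of n q)"
  proof (rule monic_poly_cong)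
    fix i assume i: "i < n"
    then have "Suc n - 1 - i = Suc (n - 1 - i)" by simp
    then show "coeffs_of (Suc n) p i = coeffs_of n q i"
      using i by (simp add: coeffs_of_def p del: diff_Suc_1)
  qed
  moreover have "coeffs_of (Suc n) p n = a" by (simp add: coeffs_of_def p)
  ultimately show ?case using Suc.IH[OF q] by (simp add: p)
qed

section \<open>Measurable maps into polynomials\<close>

text \<open>
  Stated coefficient by coefficient, so that no \<open>\<sigma>\<close>-algebra on the type of
  polynomials has to be chosen.
\<close>

definition measurable_poly :: "'a measure \<Rightarrow> ('a \<Rightarrow> complex poly) \<Rightarrow> bool" where
  "measurable_poly M f \<longleftrightarrow> (\<forall>i. (\<lambda>x. coeff (f x) i) \<in> borel_measurable M)"

lemma measurable_poly_const: "measurable_poly M (\<lambda>_. p)"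
  by (simp add: measurable_poly_def)

lemma measurable_poly_pCons:
  assumes "f \<in> borel_measurable M" "measurable_poly M g"
  shows "measurable_poly M (\<lambda>x. pCons (f x) (g x))"
  unfolding measurable_poly_def
proof
  fix i show "(\<lambda>x. coeff (pCons (f x) (g x)) i) \<in> borel_measurable M"
    using assms by (cases i) (auto simp: measurable_poly_def)
qed

lemma measurable_poly_add:
  "measurable_poly M f \<Longrightarrow> measurable_poly M g \<Longrightarrow> measurable_poly M (\<lambda>x. f x + g x)"
  by (auto simp: measurable_poly_def intro!: borel_measurable_add)

lemma measurable_poly_mult:
  "measurable_poly M f \<Longrightarrow> measurable_poly M g \<Longrightarrow> measurable_poly M (\<lambda>x. f x * g x)"
  by (auto simp: measurable_poly_def coeff_mult intro!: borel_measurable_sum borel_measurable_times)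

lemma measurable_poly_sum:
  "(\<And>i. i \<in> I \<Longrightarrow> measurable_poly M (f i)) \<Longrightarrow> measurable_poly M (\<lambda>x. \<Sum>i\<in>I. f i x)"
  by (auto simp: measurable_poly_def coeff_sum intro!: borel_measurable_sum)

lemma measurable_poly_prod:
  "(\<And>i. i \<in> I \<Longrightarrow> measurable_poly M (f i)) \<Longrightarrow> measurable_poly M (\<lambda>x. \<Prod>i\<in>I. f i x)"
  by (induction I rule: infinite_finite_induct)
     (auto intro: measurable_poly_const measurable_poly_mult)

lemma measurable_poly_monic_poly:
  assumes "\<And>i. i < n \<Longrightarrow> (\<lambda>x. c x i) \<in> borel_measurable M"
  shows "measurable_poly M (\<lambda>x. monic_poly n (c x))"
  using assms by (induction n) (auto intro: measurable_poly_const measurable_poly_pCons)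

lemma borel_measurable_poly_eval:
  assumes f: "measurable_poly M f" and deg: "\<And>x. x \<in> space M \<Longrightarrow> degree (f x) \<le> n"
    and w [measurable]: "w \<in> borel_measurable M"
  shows "(\<lambda>x. poly (f x) (w x)) \<in> borel_measurable M"
proof -
  have [measurable]: "(\<lambda>x. coeff (f x) i) \<in> borel_measurable M" for i
    using f by (simp add: measurable_poly_def)
  have "(\<lambda>x. \<Sum>i\<le>n. coeff (f x) i * w x ^ i) \<in> borel_measurable M" by measurable
  also have "?this \<longleftrightarrow> ?thesis"
    using deg unfolding poly_altdef
    by (intro measurable_cong sum.mono_neutral_right) (auto simp: coeff_eq_0)
  finally show ?thesis .
qed

text \<open>
  Functions of monic polynomials are only known to be measurable as functions of the coefficient
  vector; this transfers their measurability to any parametrization of such polynomials.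
\<close>

lemma measurable_monic:
  assumes f: "measurable_poly M f"
    and monic: "\<And>x. x \<in> space M \<Longrightarrow> degree (f x) = n \<and> coeff (f x) n = 1"
    and G: "(\<lambda>c. G (monic_poly n c)) \<in> measurable (lborel_pi n) N"
  shows "(\<lambda>x. G (f x)) \<in> measurable M N"
proof -
  have "(\<lambda>x. coeffs_of n (f x)) \<in> measurable M (lborel_pi n)"
    unfolding coeffs_of_def using f by (intro measurable_restrict) (auto simp: measurable_poly_def)
  from measurable_compose[OF this G] have "(\<lambda>x. G (monic_poly n (coeffs_of n (f x)))) \<in> measurable M N" .
  also have "?this \<longleftrightarrow> ?thesis"
    using monic by (intro measurable_cong) (simp add: monic_poly_coeffs_of)
  finally show ?thesis .
qed

section \<open>Substitutions of one coordinate at a time\<close>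

lemma nn_integral_change_coordinate:
  fixes h :: "(nat \<Rightarrow> complex) \<Rightarrow> complex \<Rightarrow> complex"
  assumes i: "i < n"
    and indep: "\<And>x y y'. h (x(i := y)) y' = h x y'"
    and subst: "\<And>x F. F \<in> borel_measurable borel \<Longrightarrow>
      (\<integral>\<^sup>+y. F (h x y) \<partial>lborel) * J = (\<integral>\<^sup>+y. F y \<partial>lborel)"
    and h [measurable]: "(\<lambda>x. h x (x i)) \<in> borel_measurable (lborel_pi n)"
    and H [measurable]: "H \<in> borel_measurable (lborel_pi n)"
  shows "(\<integral>\<^sup>+x. H (x(i := h x (x i))) \<partial>lborel_pi n) * J = (\<integral>\<^sup>+x. H x \<partial>lborel_pi n)"
proof -
  define I where "I = {..<n} - {i}"
  have I: "{..<n} = insert i I" "i \<notin> I" "finite I" using i by (auto simp: I_def)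
  have T [measurable]: "(\<lambda>x. x(i := h x (x i))) \<in> measurable (lborel_pi n) (lborel_pi n)"
    by (rule measurable_fun_upd[of _ "{..<n}"]) (use i in auto)
  have HT: "(\<lambda>x. H (x(i := h x (x i)))) \<in> borel_measurable (lborel_pi n)"
    by (rule measurable_compose[OF T H])
  have *: "(\<integral>\<^sup>+y. H (x(i := h x y)) \<partial>lborel) * J = (\<integral>\<^sup>+y. H (x(i := y)) \<partial>lborel)"
    if x: "x \<in> space (PiM I (\<lambda>_. lborel))" for x
  proof (rule subst)
    have "(\<lambda>y. x(i := y)) \<in> measurable lborel (lborel_pi n)"
      by (rule measurable_fun_upd[of _ I]) (use x I in auto)
    from measurable_compose[OF this H] show "(\<lambda>y. H (x(i := y))) \<in> borel_measurable borel"
      by simp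
  qed
  have meas: "(\<lambda>x. \<integral>\<^sup>+y. H (x(i := h x y)) \<partial>lborel) \<in> borel_measurable (PiM I (\<lambda>_. lborel))"
  proof -
    have "(\<lambda>p. (fst p)(i := snd p)) \<in> measurable (PiM I (\<lambda>_. lborel) \<Otimes>\<^sub>M lborel) (lborel_pi n)"
      by (rule measurable_fun_upd[of _ I]) (use I in auto)
    from measurable_compose[OF this HT]
    show ?thesis
      by (intro sigma_finite_measure.borel_measurable_nn_integral[OF sigma_finite_lborel])
         (simp add: case_prod_unfold indep)
  qed
  have "(\<integral>\<^sup>+x. H (x(i := h x (x i))) \<partial>lborel_pi n) * J
      = (\<integral>\<^sup>+x. (\<integral>\<^sup>+y. H (x(i := h x y)) \<partial>lborel) \<partial>PiM I (\<lambda>_. lborel)) * J"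
    unfolding I(1) by (subst lborel_product.product_nn_integral_insert)
      (use I HT in \<open>auto simp: indep\<close>)
  also have "\<dots> = (\<integral>\<^sup>+x. (\<integral>\<^sup>+y. H (x(i := h x y)) \<partial>lborel) * J \<partial>PiM I (\<lambda>_. lborel))"
    by (rule nn_integral_multc[symmetric, OF meas])
  also have "\<dots> = (\<integral>\<^sup>+x. (\<integral>\<^sup>+y. H (x(i := y)) \<partial>lborel) \<partial>PiM I (\<lambda>_. lborel))"
    by (intro nn_integral_cong *)
  also have "\<dots> = (\<integral>\<^sup>+x. H x \<partial>lborel_pi n)"
    unfolding I(1) by (subst lborel_product.product_nn_integral_insert) (use I H in auto)
  finally show ?thesis .
qed

text \<open>
  The coordinates are replaced one after the other: step \<open>m\<close> substitutes coordinate
  \<open>m\<close>, with the new values of the coordinates below \<open>m\<close> and the old values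
  of those above as parameters. Hence the Jacobians of the steps multiply.
\<close>

lemma nn_integral_triangular:
  fixes h :: "nat \<Rightarrow> (nat \<Rightarrow> complex) \<Rightarrow> complex \<Rightarrow> complex" and T :: "(nat \<Rightarrow> complex) \<Rightarrow> nat \<Rightarrow> complex"
  assumes T: "\<And>x m. m < n \<Longrightarrow> T x m = h m (\<lambda>i\<in>{..<n}. if i < m then T x i else x i) (x m)"
    and indep: "\<And>m x y y'. m < n \<Longrightarrow> h m (x(m := y)) y' = h m x y'"
    and subst: "\<And>m x F. m < n \<Longrightarrow> F \<in> borel_measurable borel \<Longrightarrow>
      (\<integral>\<^sup>+y. F (h m x y) \<partial>lborel) * J m = (\<integral>\<^sup>+y. F y \<partial>lborel)"
    and h: "\<And>m. m < n \<Longrightarrow> (\<lambda>x. h m x (x m)) \<in> borel_measurable (lborel_pi n)"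
    and H: "H \<in> borel_measurable (lborel_pi n)"
  shows "(\<integral>\<^sup>+x. H (\<lambda>i\<in>{..<n}. T x i) \<partial>lborel_pi n) * (\<Prod>m<n. J m) = (\<integral>\<^sup>+x. H x \<partial>lborel_pi n)"
proof -
  define R where "R m x = (\<lambda>i\<in>{..<n}. if i < m then T x i else x i)" for m x
  have "(\<integral>\<^sup>+x. H (R m x) \<partial>lborel_pi n) * (\<Prod>k<m. J k) = (\<integral>\<^sup>+x. H x \<partial>lborel_pi n)"
    if "m \<le> n" "H \<in> borel_measurable (lborel_pi n)" for m H
    using that
  proof (induction m arbitrary: H)
    case 0
    have "(\<integral>\<^sup>+x. H (R 0 x) \<partial>lborel_pi n) = (\<integral>\<^sup>+x. H x \<partial>lborel_pi n)"
      by (intro nn_integral_cong) (auto simp: R_def space_PiM)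
    then show ?case by simp
  next
    case (Suc m)
    then have m: "m < n" by simp
    let ?S = "\<lambda>x. x(m := h m x (x m))"
    have step: "R (Suc m) x = ?S (R m x)" for x
      using m T[OF m, of x] by (auto simp: R_def fun_eq_iff restrict_def less_Suc_eq)
    note [measurable] = h[OF m] Suc.prems(2)
    have T [measurable]: "?S \<in> measurable (lborel_pi n) (lborel_pi n)"
      by (rule measurable_fun_upd[of _ "{..<n}"]) (use m in auto)
    have "(\<integral>\<^sup>+x. H (R (Suc m) x) \<partial>lborel_pi n) * (\<Prod>k<Suc m. J k)
        = (\<integral>\<^sup>+x. H (?S (R m x)) \<partial>lborel_pi n) * (\<Prod>k<m. J k) * J m"
      by (simp add: step mult_ac)
    also have "(\<integral>\<^sup>+x. H (?S (R m x)) \<partial>lborel_pi n) * (\<Prod>k<m. J k) = (\<integral>\<^sup>+x. H (?S x) \<partial>lborel_pi n)"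
      using Suc.prems by (intro Suc.IH measurable_compose[OF T]) auto
    also have "\<dots> * J m = (\<integral>\<^sup>+x. H x \<partial>lborel_pi n)"
      by (intro nn_integral_change_coordinate m indep subst h Suc.prems)
    finally show ?case .
  qed
  from this[of n, OF _ H] show ?thesis
    by (simp add: R_def cong: restrict_cong)
qed

lemma nn_integral_affine_complex:
  fixes a b :: complex
  assumes "a \<noteq> 0" "F \<in> borel_measurable borel"
  shows "(\<integral>\<^sup>+y. F (a * y + b) \<partial>lborel) * ennreal ((cmod a)\<^sup>2) = (\<integral>\<^sup>+y. F y \<partial>lborel)"
proof -
  have "(\<lambda>y. a * y + b) \<in> borel_measurable borel" by measurable
  from measurable_compose[OF this assms(2)]
  have [measurable]: "(\<lambda>y. F (a * y + b)) \<in> borel_measurable borel" .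
  show ?thesis
    using nn_integral_poly[of "[:b, a:]" F] assms
    by (subst nn_integral_multc[symmetric]) (auto simp: pderiv_pCons algebra_simps)
qed

section \<open>The volume element of the map from roots to coefficients\<close>

abbreviation root_poly :: "nat \<Rightarrow> (nat \<Rightarrow> complex) \<Rightarrow> complex poly" where
  "root_poly n z \<equiv> (\<Prod>j<n. [:- z j, 1:])"

lemma root_poly_monic: "degree (root_poly n z) = n" "coeff (root_poly n z) n = 1"
proof -
  show 1: "degree (root_poly n z) = n" by (subst degree_prod_sum_eq) auto
  have "lead_coeff (root_poly n z) = 1" by (simp add: lead_coeff_prod)
  then show "coeff (root_poly n z) n = 1" by (simp add: 1)
qed

text \<open>
  The numbers \<open>horner w d i\<close> are the intermediate results of Horner's scheme at
  \<open>w\<close>, which are at the same time the coefficients of the quotient upon division by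
  \<open>X - w\<close>.
\<close>

definition horner :: "complex \<Rightarrow> (nat \<Rightarrow> complex) \<Rightarrow> nat \<Rightarrow> complex" where
  "horner w d i = poly (monic_poly (Suc i) d) w"

text \<open>
  Synthetic division: the constant coefficient of \<open>X Q - w Q(w)\<close>, for \<open>Q =
  monic_poly n d\<close>, is chosen so that \<open>w\<close> is a root, and the quotient has the
  Horner values as coefficients. Read backwards, the coordinates \<open>d\<close> describe the product
  of \<open>X - w\<close> with a given monic polynomial in such a way that \<open>w\<close> enters the
  constant coefficient only.
\<close>

lemma horner_division:
  "[:-w, 1:] * monic_poly n (horner w d) = pCons (- (w * poly (monic_poly n d) w)) (monic_poly n d)"
proof (induction n)
  case 0
  then show ?case by (simp add: one_pCons)
next
  case (Suc n)
  let ?q = "monic_poly n (horner w d)"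
  have "[:-w, 1:] * monic_poly (Suc n) (horner w d) = [:-w, 1:] * [:horner w d n:] + pCons 0 ([:-w, 1:] * ?q)"
    by (simp add: algebra_simps)
  also have "\<dots> = pCons (- (w * horner w d n)) (monic_poly (Suc n) d)"
    unfolding Suc.IH by (simp add: horner_def)
  finally show ?case by (simp only: horner_def[of w d n])
qed

text \<open>
  Differentiating the identity \<open>horner_division\<close> at the root \<open>w\<close>.
\<close>

lemma horner_deriv:
  "poly (monic_poly n (horner w d)) w = poly (pderiv (pCons 0 (monic_poly n d))) w"
proof -
  have "pderiv (pCons 0 (monic_poly n d))
      = pderiv ([:-w, 1:] * monic_poly n (horner w d) + [:w * poly (monic_poly n d) w:])"
    unfolding horner_division by simp
  also have "poly \<dots> w = poly (monic_poly n (horner w d)) w"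
    unfolding pderiv_mult pderiv_add poly_add poly_mult by (simp add: pderiv_pCons)
  finally show ?thesis ..
qed

text \<open>
  Each Horner value is the old coordinate translated by a multiple of the preceding Horner value.
\<close>

lemma nn_integral_horner:
  assumes H: "H \<in> borel_measurable (lborel_pi n)"
  shows "(\<integral>\<^sup>+d. H (\<lambda>i\<in>{..<n}. horner w d i) \<partial>lborel_pi n) = (\<integral>\<^sup>+c. H c \<partial>lborel_pi n)"
proof -
  define h where "h m x y = y + w * (if m = 0 then 1 else x (m - 1))" for m and x :: "nat \<Rightarrow> complex" and y :: complex
  have "(\<integral>\<^sup>+d. H (\<lambda>i\<in>{..<n}. horner w d i) \<partial>lborel_pi n) * (\<Prod>m<n. 1) = (\<integral>\<^sup>+c. H c \<partial>lborel_pi n)"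
  proof (rule nn_integral_triangular[where h = h])
    fix m assume m: "m < n"
    show "horner w x m = h m (\<lambda>i\<in>{..<n}. if i < m then horner w x i else x i) (x m)" for x
      using m by (cases m) (auto simp: h_def horner_def)
    show "h m (x(m := y)) y' = h m x y'" for x y y'
      by (auto simp: h_def)
    show "(\<integral>\<^sup>+y. F (h m x y) \<partial>lborel) * 1 = (\<integral>\<^sup>+y. F y \<partial>lborel)" if "F \<in> borel_measurable borel" for F x
      using nn_integral_affine_complex[of 1 F] that by (simp add: h_def)
    show "(\<lambda>x. h m x (x m)) \<in> borel_measurable (lborel_pi n)"
      unfolding h_def using m by (auto intro!: borel_measurable_add borel_measurable_times measurable_component_singleton)
  qed (rule H)
  then show ?thesis by simp
qed

text \<open>
  Induction on the number of roots. A new root \<open>w\<close> contributes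
  \<open>\<bar>\<Phi>(w)\<bar>\<^sup>2\<close> to the squared Vandermonde product, where
  \<open>\<Phi>\<close> has the old roots. In Horner coordinates this factor is
  \<open>\<bar>p'(w)\<bar>\<^sup>2\<close> for \<open>p = - X Q\<close>, and \<open>p(w)\<close> is
  the new constant coefficient; so integrating over \<open>w\<close> yields the factor \<open>degree p
  = n + 1\<close> by \<open>nn_integral_poly\<close>.
\<close>

lemma nn_integral_vieta:
  fixes G :: "complex poly \<Rightarrow> ennreal"
  assumes "(\<lambda>c. G (monic_poly n c)) \<in> borel_measurable (lborel_pi n)"
  shows "(\<integral>\<^sup>+z. G (root_poly n z) * (\<Prod>k<n. \<Prod>j<k. ennreal ((cmod (z k - z j))\<^sup>2)) \<partial>lborel_pi n)
       = fact n * (\<integral>\<^sup>+c. G (monic_poly n c) \<partial>lborel_pi n)"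
  using assms
proof (induction n arbitrary: G)
  case 0
  show ?case by simp
next
  case (Suc n)
  note G = Suc.prems
  interpret S: sigma_finite_measure "lborel_pi n"
    by (rule lborel_product.sigma_finite) simp
  interpret PS: pair_sigma_finite "lborel_pi n" "lborel :: complex measure" ..
  \<comment> \<open>The integrand after the root \<open>w\<close> has been adjoined to \<open>p\<close>.\<close>
  define W where "W p w = G (p * [:-w, 1:]) * ennreal ((cmod (poly p w))\<^sup>2)" for p w
  define V where "V n z = (\<Prod>k<n. \<Prod>j<k. ennreal ((cmod (z k - z j))\<^sup>2))" for n and z :: "nat \<Rightarrow> complex"
  have lin: "measurable_poly M (\<lambda>x. [:- f x, 1:])" if "f \<in> borel_measurable M" for M :: "'a measure" and f
    using that by (intro measurable_poly_pCons measurable_poly_const) auto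
  have mon: "measurable_poly (lborel_pi n \<Otimes>\<^sub>M lborel) (\<lambda>x. monic_poly n (fst x))"
    by (intro measurable_poly_monic_poly measurable_fst_coordinate)
  have lm: "degree (monic_poly n c * [:-w, 1:]) = Suc n \<and> coeff (monic_poly n c * [:-w, 1:]) (Suc n) = 1" for c w
  proof -
    have "degree (monic_poly n c * [:-w, 1:]) = Suc n"
      by (subst degree_mult_eq) (auto simp: monic_poly_monic)
    moreover have "lead_coeff (monic_poly n c * [:-w, 1:]) = 1"
      unfolding lead_coeff_mult by (simp add: monic_poly_monic)
    ultimately show ?thesis by simp
  qed
  have W_meas: "(\<lambda>x. W (monic_poly n (fst x)) (snd x)) \<in> borel_measurable (lborel_pi n \<Otimes>\<^sub>M lborel)"
  proof -
    have "(\<lambda>x. G (monic_poly n (fst x) * [:- snd x, 1:])) \<in> borel_measurable (lborel_pi n \<Otimes>\<^sub>M lborel)"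
      by (rule measurable_monic[OF _ _ G, of _ ])
         (rule measurable_poly_mult mon lin lm | simp)+
    moreover have "(\<lambda>x. poly (monic_poly n (fst x)) (snd x)) \<in> borel_measurable (lborel_pi n \<Otimes>\<^sub>M lborel)"
      by (rule borel_measurable_poly_eval[OF mon, of n]) (auto simp: monic_poly_monic)
    ultimately show ?thesis unfolding W_def by measurable
  qed
  have V_meas [measurable]: "V n \<in> borel_measurable (lborel_pi n)"
    unfolding V_def
    by (intro borel_measurable_prod_ennreal measurable_compose[OF _ measurable_ennreal] borel_measurable_power
         borel_measurable_norm borel_measurable_diff measurable_component_singleton) auto
  have GV_meas: "(\<lambda>z. G (\<Prod>j<Suc n. [:- z j, 1:]) * V (Suc n) z) \<in> borel_measurable (lborel_pi (Suc n))"
    unfolding V_def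
    by (intro borel_measurable_times_ennreal borel_measurable_prod_ennreal measurable_compose[OF _ measurable_ennreal] borel_measurable_power
         borel_measurable_norm borel_measurable_diff measurable_component_singleton
         measurable_monic[OF _ _ G] measurable_poly_prod lin) (auto simp: root_poly_monic simp del: prod.lessThan_Suc)
  have ins: "{..<Suc n} = insert n {..<n}" by auto
  have "(\<integral>\<^sup>+z. G (\<Prod>j<Suc n. [:- z j, 1:]) * V (Suc n) z \<partial>lborel_pi (Suc n))
      = (\<integral>\<^sup>+z. (\<integral>\<^sup>+w. G (\<Prod>j<Suc n. [:- (z(n := w)) j, 1:]) * V (Suc n) (z(n := w)) \<partial>lborel) \<partial>lborel_pi n)"
    using GV_meas unfolding ins by (intro lborel_product.product_nn_integral_insert) auto
  also have "\<dots> = (\<integral>\<^sup>+z. (\<integral>\<^sup>+w. W (root_poly n z) w * V n z \<partial>lborel) \<partial>lborel_pi n)"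
  proof (intro nn_integral_cong)
    fix z :: "nat \<Rightarrow> complex" and w :: complex
    have 1: "(\<Prod>j<Suc n. [:- (z(n := w)) j, 1:]) = (root_poly n z) * [:-w, 1:]"
      unfolding prod.lessThan_Suc by (intro arg_cong2[where f = "(*)"] prod.cong) auto
    have 2: "V (Suc n) (z(n := w)) = V n z * ennreal ((cmod (poly (root_poly n z) w))\<^sup>2)"
      unfolding V_def prod.lessThan_Suc
      by (intro arg_cong2[where f = "(*)"] prod.cong)
         (auto simp: poly_prod prod_norm[symmetric] prod_power_distrib prod_ennreal)
    show "G (\<Prod>j<Suc n. [:- (z(n := w)) j, 1:]) * V (Suc n) (z(n := w)) = W (root_poly n z) w * V n z"
      unfolding 1 2 W_def by (simp only: mult_ac)
  qed
  also have "\<dots> = (\<integral>\<^sup>+z. (\<integral>\<^sup>+w. W (root_poly n z) w \<partial>lborel) * V n z \<partial>lborel_pi n)"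
  proof (intro nn_integral_cong nn_integral_multc)
    fix z :: "nat \<Rightarrow> complex"
    have "(\<lambda>w. (restrict (coeffs_of n (root_poly n z)) {..<n}, w)) \<in> measurable lborel (lborel_pi n \<Otimes>\<^sub>M lborel)"
      by (auto simp: space_PiM)
    from measurable_compose[OF this W_meas] show "W (root_poly n z) \<in> borel_measurable lborel"
      by (simp add: monic_poly_coeffs_of root_poly_monic)
  qed
  also have "\<dots> = fact n * (\<integral>\<^sup>+c. (\<integral>\<^sup>+w. W (monic_poly n c) w \<partial>lborel) \<partial>lborel_pi n)"
    unfolding V_def
  proof (rule Suc.IH)
    show "(\<lambda>c. \<integral>\<^sup>+w. W (monic_poly n c) w \<partial>lborel) \<in> borel_measurable (lborel_pi n)"
      by (rule sigma_finite_measure.borel_measurable_nn_integral[OF sigma_finite_lborel]) (simp add: case_prod_unfold W_meas)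
  qed
  also have "(\<integral>\<^sup>+c. (\<integral>\<^sup>+w. W (monic_poly n c) w \<partial>lborel) \<partial>lborel_pi n)
      = (\<integral>\<^sup>+w. (\<integral>\<^sup>+c. W (monic_poly n c) w \<partial>lborel_pi n) \<partial>lborel)"
    by (rule PS.Fubini'[symmetric]) (simp add: case_prod_unfold W_meas)
  also have "\<dots> = (\<integral>\<^sup>+w. (\<integral>\<^sup>+d. G (pCons (- (w * poly (monic_poly n d) w)) (monic_poly n d))
        * ennreal ((cmod (poly (pderiv (pCons 0 (monic_poly n d))) w))\<^sup>2) \<partial>lborel_pi n) \<partial>lborel)"
  proof (rule nn_integral_cong)
    fix w :: complex
    have "(\<lambda>c. (c, w)) \<in> measurable (lborel_pi n) (lborel_pi n \<Otimes>\<^sub>M lborel)" by measurable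
    from measurable_compose[OF this W_meas]
    have "(\<lambda>c. W (monic_poly n c) w) \<in> borel_measurable (lborel_pi n)" by simp
    from nn_integral_horner[OF this, of w]
    show "(\<integral>\<^sup>+c. W (monic_poly n c) w \<partial>lborel_pi n) = (\<integral>\<^sup>+d. G (pCons (- (w * poly (monic_poly n d) w)) (monic_poly n d))
        * ennreal ((cmod (poly (pderiv (pCons 0 (monic_poly n d))) w))\<^sup>2) \<partial>lborel_pi n)"
      by (simp only: W_def horner_deriv horner_division monic_poly_restrict order_refl mult.commute[of _ "[:-w, 1:]"])
  qed
  also have "\<dots> = (\<integral>\<^sup>+d. (\<integral>\<^sup>+w. G (pCons (- (w * poly (monic_poly n d) w)) (monic_poly n d))
        * ennreal ((cmod (poly (pderiv (pCons 0 (monic_poly n d))) w))\<^sup>2) \<partial>lborel) \<partial>lborel_pi n)"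
  proof (rule PS.Fubini')
    have ev: "(\<lambda>x. poly (monic_poly n (fst x)) (snd x)) \<in> borel_measurable (lborel_pi n \<Otimes>\<^sub>M lborel)"
      by (rule borel_measurable_poly_eval[OF mon, of n]) (auto simp: monic_poly_monic)
    have "(\<lambda>x. G (pCons (- (snd x * poly (monic_poly n (fst x)) (snd x))) (monic_poly n (fst x))))
        \<in> borel_measurable (lborel_pi n \<Otimes>\<^sub>M lborel)"
      by (rule measurable_monic[OF _ _ G, of _ ])
         (use ev in \<open>auto intro!: measurable_poly_pCons mon borel_measurable_uminus borel_measurable_times simp: monic_poly_monic\<close>)
    moreover have "(\<lambda>x. poly (pderiv (pCons 0 (monic_poly n (fst x)))) (snd x)) \<in> borel_measurable (lborel_pi n \<Otimes>\<^sub>M lborel)"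
    proof (rule borel_measurable_poly_eval[of _ _ n])
      show "measurable_poly (lborel_pi n \<Otimes>\<^sub>M lborel) (\<lambda>x. pderiv (pCons 0 (monic_poly n (fst x))))"
        using mon by (auto simp: measurable_poly_def coeff_pderiv intro!: borel_measurable_times)
    qed (auto simp: degree_pderiv monic_poly_monic)
    ultimately show "(\<lambda>(d, w). G (pCons (- (w * poly (monic_poly n d) w)) (monic_poly n d))
        * ennreal ((cmod (poly (pderiv (pCons 0 (monic_poly n d))) w))\<^sup>2)) \<in> borel_measurable (lborel_pi n \<Otimes>\<^sub>M lborel)"
      unfolding case_prod_unfold by measurable
  qed
  also have "\<dots> = (\<integral>\<^sup>+d. of_nat (Suc n) * (\<integral>\<^sup>+u. G (monic_poly (Suc n) (d(n := u))) \<partial>lborel) \<partial>lborel_pi n)"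
  proof (rule nn_integral_cong)
    fix d assume d: "d \<in> space (lborel_pi n)"
    have deg: "degree (- pCons 0 (monic_poly n d)) = Suc n" by (simp add: monic_poly_monic)
    have "(\<lambda>u. d(n := u)) \<in> measurable lborel (lborel_pi (Suc n))"
      by (rule measurable_fun_upd[of _ "{..<n}"]) (use d in auto)
    from measurable_compose[OF this G] have F: "(\<lambda>u. G (pCons u (monic_poly n d))) \<in> borel_measurable borel"
      by (simp only: monic_poly.simps monic_poly_upd fun_upd_same measurable_lborel1 measurable_lborel2)
    show "(\<integral>\<^sup>+w. G (pCons (- (w * poly (monic_poly n d) w)) (monic_poly n d))
        * ennreal ((cmod (poly (pderiv (pCons 0 (monic_poly n d))) w))\<^sup>2) \<partial>lborel)
      = of_nat (Suc n) * (\<integral>\<^sup>+u. G (monic_poly (Suc n) (d(n := u))) \<partial>lborel)"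
      using nn_integral_poly[OF _ F, of "- pCons 0 (monic_poly n d)"] unfolding deg pderiv_minus
      by (simp add: monic_poly_upd del: fun_upd_apply minus_pCons) (simp add: fun_upd_same)
  qed
  also have "\<dots> = of_nat (Suc n) * (\<integral>\<^sup>+d. (\<integral>\<^sup>+u. G (monic_poly (Suc n) (d(n := u))) \<partial>lborel) \<partial>lborel_pi n)"
  proof (rule nn_integral_cmult, rule sigma_finite_measure.borel_measurable_nn_integral[OF sigma_finite_lborel])
    have "(\<lambda>p. (fst p)(n := snd p)) \<in> measurable (lborel_pi n \<Otimes>\<^sub>M lborel) (lborel_pi (Suc n))"
      by (rule measurable_fun_upd[of _ "{..<n}"]) auto
    from measurable_compose[OF this G]
    show "(\<lambda>(d, u). G (monic_poly (Suc n) (d(n := u)))) \<in> borel_measurable (lborel_pi n \<Otimes>\<^sub>M lborel)"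
      by (simp only: case_prod_unfold)
  qed
  also have "(\<integral>\<^sup>+d. (\<integral>\<^sup>+u. G (monic_poly (Suc n) (d(n := u))) \<partial>lborel) \<partial>lborel_pi n) = (\<integral>\<^sup>+c. G (monic_poly (Suc n) c) \<partial>lborel_pi (Suc n))"
    using G unfolding ins by (intro lborel_product.product_nn_integral_insert[symmetric]) auto
  finally show ?case
    by (simp only: V_def fact_Suc of_nat_mult mult_ac of_nat_fact)
qed

section \<open>The Szego recursion\<close>

text \<open>
  The reversed polynomial \<open>X\<^sup>n cnj (p (1 / cnj X))\<close>, where \<open>n\<close> is the
  degree of \<open>p\<close>.
\<close>

definition star_poly :: "complex poly \<Rightarrow> complex poly" where
  "star_poly p = reflect_poly (map_poly cnj p)"

lemma degree_map_poly_cnj [simp]: "degree (map_poly cnj p) = degree p"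
  by (rule degree_map_poly) auto

lemma coeff_star_poly:
  "coeff (star_poly p) j = (if j \<le> degree p then cnj (coeff p (degree p - j)) else 0)"
  by (simp add: star_poly_def coeff_reflect_poly coeff_map_poly)

lemma star_poly_linear: "star_poly [:-w, 1:] = [:1, - cnj w:]"
  by (rule poly_eqI) (auto simp: coeff_star_poly coeff_pCons split: nat.splits)

lemma star_poly_mult: "star_poly (p * q) = star_poly p * star_poly q"
proof -
  have "map_poly cnj (p * q) = map_poly cnj p * map_poly cnj q"
    by (rule poly_eqI) (simp add: coeff_map_poly coeff_mult)
  then show ?thesis by (simp add: star_poly_def reflect_poly_mult)
qed

lemma star_poly_1: "star_poly 1 = 1"
  by (simp add: star_poly_def)

lemma star_poly_prod: "star_poly (\<Prod>j\<in>A. f j) = (\<Prod>j\<in>A. star_poly (f j))"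
  by (induction A rule: infinite_finite_induct) (auto simp: star_poly_mult star_poly_1)

lemma poly_root_poly: "poly (root_poly n z) x = (\<Prod>j<n. x - z j)"
  by (simp add: poly_prod)

lemma poly_star_root_poly: "poly (star_poly (root_poly n z)) x = (\<Prod>j<n. 1 - x * cnj (z j))"
  by (simp add: star_poly_prod star_poly_linear poly_prod)

lemma proots_root_poly: "proots (root_poly n z) = image_mset z (mset_set {..<n})"
proof -
  have "proots (root_poly n z) = (\<Sum>j<n. {#z j#})"
    by (subst proots_prod) auto
  also have "\<dots> = image_mset z (mset_set {..<n})"
    by (induction n) (auto simp: lessThan_Suc)
  finally show ?thesis .
qed

lemma monic_root_poly:
  fixes p :: "complex poly"
  assumes "degree p = n" "coeff p n = 1"
  obtains z where "p = root_poly n z"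
  using complex_poly_decompose'[of p] assms by (metis smult_1_left)

definition stable :: "complex poly \<Rightarrow> bool" where
  "stable p \<longleftrightarrow> (\<forall>z. poly p z = 0 \<longrightarrow> cmod z < 1)"

lemma stable_root_poly: "stable (root_poly n z) \<longleftrightarrow> (\<forall>j<n. cmod (z j) < 1)"
  by (auto simp: stable_def poly_root_poly)

text \<open>
  Root by root: \<open>\<bar>x - z\<bar>\<^sup>2 - \<bar>1 - x cnj z\<bar>\<^sup>2 =
  (\<bar>x\<bar>\<^sup>2 - 1)(1 - \<bar>z\<bar>\<^sup>2)\<close>.
\<close>

lemma stable_star_le:
  assumes "degree p = n" "coeff p n = 1" "stable p" "cmod x \<ge> 1"
  shows "cmod (poly (star_poly p) x) \<le> cmod (poly p x)"
proof -
  obtain z where p: "p = root_poly n z" using monic_root_poly assms by metis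
  have "cmod (1 - x * cnj (z j)) \<le> cmod (x - z j)" if "j < n" for j
  proof -
    have z: "cmod (z j) < 1" using assms(3) that by (auto simp: p stable_root_poly)
    have "(cmod (x - z j))\<^sup>2 - (cmod (1 - x * cnj (z j)))\<^sup>2 = ((cmod x)\<^sup>2 - 1) * (1 - (cmod (z j))\<^sup>2)"
      unfolding cmod_power2 by (simp add: power2_eq_square algebra_simps)
    also have "\<dots> \<ge> 0" using z assms(4) by (intro mult_nonneg_nonneg) (auto simp: power_le_one)
    finally have "(cmod (1 - x * cnj (z j)))\<^sup>2 \<le> (cmod (x - z j))\<^sup>2" by linarith
    then show ?thesis by (rule power2_le_imp_le) simp
  qed
  then show ?thesis
    unfolding p poly_root_poly poly_star_root_poly prod_norm[symmetric]
    by (intro prod_mono) auto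
qed

definition szego_step :: "complex \<Rightarrow> complex poly \<Rightarrow> complex poly" where
  "szego_step a p = pCons 0 p - Polynomial.smult (cnj a) (star_poly p)"

lemma szego_step_monic:
  assumes "degree p = n" "coeff p n = 1"
  shows "degree (szego_step a p) = Suc n" "coeff (szego_step a p) (Suc n) = 1"
proof -
  show 1: "coeff (szego_step a p) (Suc n) = 1"
    using assms by (simp add: szego_step_def coeff_star_poly)
  have "degree (szego_step a p) \<le> Suc n"
    using assms by (intro degree_le) (auto simp: szego_step_def coeff_star_poly coeff_pCons coeff_eq_0 split: nat.splits)
  moreover have "degree (szego_step a p) \<ge> Suc n" using 1 by (intro le_degree) auto
  ultimately show "degree (szego_step a p) = Suc n" by simp
qed

text \<open>
  The reversal is taken with respect to the degree \<open>n + 1\<close>, where it exchanges \<open>X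
  p\<close> and \<open>p\<^sup>*\<close>.
\<close>

lemma star_szego_step:
  assumes "degree p = n" "coeff p n = 1"
  shows "star_poly (szego_step a p) = star_poly p - Polynomial.smult a (pCons 0 p)"
proof (rule poly_eqI)
  fix j
  show "coeff (star_poly (szego_step a p)) j = coeff (star_poly p - Polynomial.smult a (pCons 0 p)) j"
  proof (cases j)
    case 0
    then show ?thesis
      using assms by (simp add: coeff_star_poly szego_step_monic[OF assms])
  next
    case (Suc i)
    consider "i < n" | "i = n" | "i > n" by linarith
    then show ?thesis
    proof cases
      case 1
      then have "n - i = Suc (n - Suc i)" by simp
      with 1 Suc show ?thesis
        using assms by (simp add: coeff_star_poly szego_step_monic[OF assms]) (simp add: szego_step_def coeff_star_poly)
    qed (use Suc assms in \<open>simp_all add: coeff_star_poly szego_step_monic[OF assms] coeff_eq_0\<close>,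
         simp_all add: szego_step_def coeff_star_poly)
  qed
qed

text \<open>
  A root outside the disc would violate \<open>stable_star_le\<close>, applied to \<open>p\<close> for
  the step forward, and to the new polynomial \<open>P\<close> for the step backward, where \<open>(1
  - \<bar>a\<bar>\<^sup>2) X p = P + cnj a P\<^sup>*\<close>.
\<close>

lemma stable_szego_step:
  assumes p: "degree p = n" "coeff p n = 1" and a: "cmod a < 1"
  shows "stable (szego_step a p) \<longleftrightarrow> stable p"
proof
  assume st: "stable p"
  show "stable (szego_step a p)"
    unfolding stable_def
  proof (intro allI impI, rule ccontr)
    fix z assume 0: "poly (szego_step a p) z = 0" and z: "\<not> cmod z < 1"
    have nz: "poly p z \<noteq> 0" using st z by (auto simp: stable_def)
    have "z * poly p z = cnj a * poly (star_poly p) z" using 0 by (simp add: szego_step_def)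
    then have "cmod z * cmod (poly p z) = cmod a * cmod (poly (star_poly p) z)"
      by (metis norm_mult complex_mod_cnj)
    also have "\<dots> \<le> cmod a * cmod (poly p z)"
      using stable_star_le[OF p st] z by (intro mult_left_mono) auto
    finally show False using nz z a by auto
  qed
next
  assume st: "stable (szego_step a p)"
  let ?P = "szego_step a p"
  show "stable p"
    unfolding stable_def
  proof (intro allI impI, rule ccontr)
    fix z assume 0: "poly p z = 0" and z: "\<not> cmod z < 1"
    have nz: "poly ?P z \<noteq> 0" using st z by (auto simp: stable_def)
    have "poly ?P z = - cnj a * poly (star_poly ?P) z"
      using 0 by (simp add: star_szego_step[OF p]) (simp add: szego_step_def)
    then have "cmod (poly ?P z) = cmod a * cmod (poly (star_poly ?P) z)"
      by (simp add: norm_mult)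
    also have "\<dots> \<le> cmod a * cmod (poly ?P z)"
      using stable_star_le[OF szego_step_monic[OF p] st] z by (intro mult_left_mono) auto
    finally show False using nz a by auto
  qed
qed

text \<open>
  The constant coefficient is, up to sign, the product of the roots. With \<open>szego_step\<close>
  this says that every polynomial with all roots in the disc has an admissible last Verblunsky
  coefficient.
\<close>

lemma stable_const_coeff:
  assumes "degree p = Suc n" "coeff p (Suc n) = 1" "stable p"
  shows "cmod (coeff p 0) < 1"
proof -
  obtain z where p: "p = root_poly (Suc n) z" using monic_root_poly assms by metis
  have z: "cmod (z j) < 1" if "j < Suc n" for j
    using assms(3) that unfolding p stable_root_poly by blast
  have "cmod (coeff p 0) = (\<Prod>j<Suc n. cmod (z j))"
    unfolding p poly_0_coeff_0[symmetric] poly_root_poly prod_norm[symmetric] by simp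
  also have "\<dots> = (\<Prod>j<n. cmod (z j)) * cmod (z n)" by simp
  also have "\<dots> \<le> 1 * cmod (z n)"
    using z by (intro mult_right_mono prod_le_1) (auto intro: less_imp_le)
  finally show ?thesis using z[of n] by simp
qed

text \<open>
  The modulus of the resultant of \<open>p\<close> and its reversed polynomial.
\<close>

definition schur_resultant :: "complex poly \<Rightarrow> real" where
  "schur_resultant p = (\<Prod>x\<in>#proots p. cmod (poly (star_poly p) x))"

lemma schur_resultant_root_poly:
  "schur_resultant (root_poly n z) = (\<Prod>j<n. \<Prod>k<n. cmod (1 - z j * cnj (z k)))"
  unfolding schur_resultant_def proots_root_poly poly_star_root_poly
  by (simp add: prod_unfold_prod_mset[symmetric] image_mset.compositionality comp_def prod_norm)

text \<open>
  Write \<open>P\<close> for the new polynomial. At its roots \<open>X p = cnj a p\<^sup>*\<close>, so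
  \<open>P\<^sup>* = (1 - \<bar>a\<bar>\<^sup>2) p\<^sup>*\<close> there; this gives the power of
  \<open>1 - \<bar>a\<bar>\<^sup>2\<close>. The remaining product of \<open>p\<^sup>*\<close> over the
  roots of \<open>P\<close> is, up to conjugation, the product of \<open>P\<^sup>*\<close> over the
  roots of \<open>p\<close>, and \<open>P\<^sup>* = p\<^sup>*\<close> at the roots of
  \<open>p\<close>.
\<close>

lemma schur_resultant_szego_step:
  assumes p: "degree p = n" "coeff p n = 1" and a: "cmod a < 1"
  shows "schur_resultant (szego_step a p) = (1 - (cmod a)\<^sup>2) ^ Suc n * schur_resultant p"
proof -
  let ?P = "szego_step a p"
  obtain w where w: "p = root_poly n w" using monic_root_poly p by metis
  obtain z where z: "?P = root_poly (Suc n) z" using monic_root_poly szego_step_monic[OF p] by metis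
  have star: "poly (star_poly ?P) x = poly (star_poly p) x - a * (x * poly p x)" for x
    unfolding star_szego_step[OF p] by simp
  have at_z: "cmod (poly (star_poly ?P) (z j)) = (1 - (cmod a)\<^sup>2) * cmod (poly (star_poly p) (z j))"
    if "j < Suc n" for j
  proof -
    have "poly ?P (z j) = 0" unfolding z poly_root_poly using that by (intro prod_zero) auto
    then have "z j * poly p (z j) = cnj a * poly (star_poly p) (z j)" by (simp add: szego_step_def)
    then have "poly (star_poly ?P) (z j) = (1 - a * cnj a) * poly (star_poly p) (z j)"
      unfolding star by (simp add: algebra_simps)
    also have "1 - a * cnj a = complex_of_real (1 - (cmod a)\<^sup>2)"
      unfolding of_real_diff complex_norm_square by simp
    finally show ?thesis
      using a by (simp only: norm_mult norm_of_real) (simp add: abs_square_le_1 abs_of_nonneg power_le_one)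
  qed
  have at_w: "poly (star_poly ?P) (w l) = poly (star_poly p) (w l)" if "l < n" for l
  proof -
    have "poly p (w l) = 0" unfolding w poly_root_poly using that by (intro prod_zero) auto
    then show ?thesis unfolding star by simp
  qed
  have "schur_resultant ?P = (\<Prod>j<Suc n. cmod (poly (star_poly ?P) (z j)))"
    unfolding z schur_resultant_root_poly poly_star_root_poly prod_norm ..
  also have "\<dots> = (\<Prod>j<Suc n. (1 - (cmod a)\<^sup>2) * cmod (poly (star_poly p) (z j)))"
    by (intro prod.cong at_z) auto
  also have "\<dots> = (1 - (cmod a)\<^sup>2) ^ Suc n * (\<Prod>j<Suc n. cmod (poly (star_poly p) (z j)))"
    unfolding prod.distrib prod_constant card_lessThan ..
  also have "(\<Prod>j<Suc n. cmod (poly (star_poly p) (z j))) = (\<Prod>j<Suc n. \<Prod>l<n. cmod (1 - z j * cnj (w l)))"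
    unfolding w poly_star_root_poly prod_norm ..
  also have "\<dots> = (\<Prod>l<n. \<Prod>j<Suc n. cmod (1 - w l * cnj (z j)))"
  proof (subst prod.swap, intro prod.cong refl)
    fix l j
    have "1 - z j * cnj (w l) = cnj (1 - w l * cnj (z j))" by simp
    then show "cmod (1 - z j * cnj (w l)) = cmod (1 - w l * cnj (z j))" by (metis complex_mod_cnj)
  qed
  also have "\<dots> = (\<Prod>l<n. cmod (poly (star_poly ?P) (w l)))"
    unfolding z poly_star_root_poly prod_norm ..
  also have "\<dots> = (\<Prod>l<n. cmod (poly (star_poly p) (w l)))"
    by (intro prod.cong refl) (simp add: at_w)
  also have "\<dots> = schur_resultant p"
    unfolding w schur_resultant_root_poly poly_star_root_poly prod_norm ..
  finally show ?thesis .
qed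

primrec szego :: "(nat \<Rightarrow> complex) \<Rightarrow> nat \<Rightarrow> complex poly" where
  "szego \<alpha> 0 = 1"
| "szego \<alpha> (Suc n) = szego_step (\<alpha> n) (szego \<alpha> n)"

lemma szego_monic: "degree (szego \<alpha> n) = n" "coeff (szego \<alpha> n) n = 1"
proof -
  have "degree (szego \<alpha> n) = n \<and> coeff (szego \<alpha> n) n = 1"
    by (induction n) (auto simp: szego_step_monic)
  then show "degree (szego \<alpha> n) = n" "coeff (szego \<alpha> n) n = 1" by auto
qed

lemma szego_cong: "(\<And>i. i < n \<Longrightarrow> \<alpha> i = \<gamma> i) \<Longrightarrow> szego \<alpha> n = szego \<gamma> n"
  by (induction n) auto

lemma measurable_poly_szego_step:
  assumes "measurable_poly M f" "\<And>x. x \<in> space M \<Longrightarrow> degree (f x) = n" "a \<in> borel_measurable M"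
  shows "measurable_poly M (\<lambda>x. szego_step (a x) (f x))"
  unfolding measurable_poly_def
proof
  fix i
  have [measurable]: "(\<lambda>x. coeff (f x) i) \<in> borel_measurable M" for i
    using assms by (simp add: measurable_poly_def)
  note [measurable] = assms(3) measurable_compose[OF _ borel_measurable_cnj]
  have 1: "(\<lambda>x. coeff (pCons 0 (f x)) i) \<in> borel_measurable M" by (cases i) auto
  have "(\<lambda>x. coeff (pCons 0 (f x)) i - cnj (a x) * (if i \<le> n then cnj (coeff (f x) (n - i)) else 0)) \<in> borel_measurable M"
    using 1 by measurable
  also have "?this \<longleftrightarrow> (\<lambda>x. coeff (szego_step (a x) (f x)) i) \<in> borel_measurable M"
    using assms(2) by (intro measurable_cong) (auto simp: szego_step_def coeff_star_poly)
  finally show "(\<lambda>x. coeff (szego_step (a x) (f x)) i) \<in> borel_measurable M" .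
qed

lemma measurable_poly_szego:
  assumes "\<And>i. i < n \<Longrightarrow> (\<lambda>x. \<alpha> x i) \<in> borel_measurable M"
  shows "measurable_poly M (\<lambda>x. szego (\<alpha> x) n)"
  using assms
  by (induction n) (auto intro!: measurable_poly_const measurable_poly_szego_step simp: szego_monic)

section \<open>The volume element of one Szego step\<close>

text \<open>
  The coefficients other than the constant one after a Szego step; coordinate \<open>i\<close> is
  coupled only to its mirror image \<open>n - 1 - i\<close>.
\<close>

definition szego_coeffs :: "complex \<Rightarrow> nat \<Rightarrow> (nat \<Rightarrow> complex) \<Rightarrow> nat \<Rightarrow> complex" where
  "szego_coeffs a n c i = c i - cnj a * cnj (c (n - 1 - i))"

lemma coeff_monic_poly: "i < n \<Longrightarrow> coeff (monic_poly n c) (n - 1 - i) = c i"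
proof (induction n)
  case (Suc n)
  show ?case
  proof (cases "i = n")
    case False
    then have "Suc n - 1 - i = Suc (n - 1 - i)" using Suc.prems by simp
    then show ?thesis using Suc False by (simp del: diff_Suc_1)
  qed simp
qed simp

lemma szego_step_monic_poly:
  "szego_step a (monic_poly n c) = monic_poly (Suc n) ((szego_coeffs a n c)(n := - cnj a))" (is "?L = ?R")
proof -
  let ?m = "monic_poly n c"
  have eq: "coeff ?L (n - i) = coeff ?R (n - i)" if i: "i < Suc n" for i
  proof (cases "i = n")
    case True
    then show ?thesis by (simp add: szego_step_def coeff_star_poly monic_poly_monic)
  next
    case False
    with i have i: "i < n" by simp
    have "coeff ?R (n - i) = szego_coeffs a n c i"
      using coeff_monic_poly[of i "Suc n" "(szego_coeffs a n c)(n := - cnj a)"] i by simp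
    moreover have "coeff (pCons 0 ?m) (n - i) = c i"
    proof -
      have "n - i = Suc (n - 1 - i)" using i by simp
      then show ?thesis using coeff_monic_poly[OF i, of c] by (metis coeff_pCons_Suc)
    qed
    moreover have "coeff (star_poly ?m) (n - i) = cnj (c (n - 1 - i))"
      using i coeff_monic_poly[of "n - 1 - i" n c] by (simp add: coeff_star_poly monic_poly_monic)
    ultimately show ?thesis by (simp add: szego_step_def szego_coeffs_def)
  qed
  have L: "degree ?L = Suc n" "coeff ?L (Suc n) = 1"
    using szego_step_monic monic_poly_monic by auto
  show ?thesis
  proof (rule poly_eqI)
    fix j
    consider "j \<le> n" | "j = Suc n" | "j > Suc n" by linarith
    then show "coeff ?L j = coeff ?R j"
    proof cases
      case 1
      then show ?thesis using eq[of "n - j"] by simp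
    next
      case 2
      then show ?thesis using L monic_poly_monic by metis
    next
      case 3
      then show ?thesis using L by (simp add: coeff_eq_0 monic_poly_monic del: monic_poly.simps)
    qed
  qed
qed

text \<open>
  For a pair of mirror coordinates \<open>x\<close>, \<open>y\<close>, the map \<open>(x - cnj a cnj
  y, y - cnj a cnj x)\<close> is done in two steps: first \<open>x\<close> is translated to its new
  value \<open>x'\<close>, then \<open>y\<close> becomes \<open>(1 - \<bar>a\<bar>\<^sup>2) y - cnj a
  cnj x'\<close>. A pair thus contributes \<open>(1 - \<bar>a\<bar>\<^sup>2)\<^sup>2\<close>, and a
  middle coordinate contributes \<open>1 - \<bar>a\<bar>\<^sup>2\<close> by
  \<open>nn_integral_conj_affine\<close>.
\<close>

lemma nn_integral_szego_coeffs:
  assumes a: "cmod a < 1" and H: "H \<in> borel_measurable (lborel_pi n)"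
  shows "(\<integral>\<^sup>+c. H (\<lambda>i\<in>{..<n}. szego_coeffs a n c i) \<partial>lborel_pi n) * ennreal ((1 - (cmod a)\<^sup>2) ^ n) = (\<integral>\<^sup>+c. H c \<partial>lborel_pi n)"
proof -
  define d where "d = 1 - (cmod a)\<^sup>2"
  have d: "d > 0" using a by (simp add: d_def abs_square_less_1)
  have dd: "complex_of_real d = 1 - a * cnj a"
    by (simp add: d_def flip: complex_norm_square)
  define h where "h m x y = (if m < n - 1 - m then y - cnj a * cnj (x (n - 1 - m))
      else if m = n - 1 - m then y - cnj a * cnj y
      else complex_of_real d * y - cnj a * cnj (x (n - 1 - m)))" for m and x :: "nat \<Rightarrow> complex" and y :: complex
  \<comment> \<open>Step \<open>m\<close> has Jacobian \<open>d ^ e m\<close>, and mirror images have exponents with sum \<open>2\<close>.\<close>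
  define e where "e m = (if m < n - 1 - m then 0 else if m = n - 1 - m then 1 else 2 :: nat)" for m
  have "(\<integral>\<^sup>+c. H (\<lambda>i\<in>{..<n}. szego_coeffs a n c i) \<partial>lborel_pi n) * (\<Prod>m<n. ennreal (d ^ e m)) = (\<integral>\<^sup>+c. H c \<partial>lborel_pi n)"
  proof (rule nn_integral_triangular[where h = h])
    fix m assume m: "m < n"
    show "szego_coeffs a n x m = h m (\<lambda>i\<in>{..<n}. if i < m then szego_coeffs a n x i else x i) (x m)" for x
    proof -
      consider "m < n - 1 - m" | "m = n - 1 - m" | "n - 1 - m < m" by linarith
      then show ?thesis
      proof cases
        case 3
        then have 1: "n - 1 - (n - 1 - m) = m" using m by simp
        have "szego_coeffs a n x m = complex_of_real d * x m - cnj a * cnj (szego_coeffs a n x (n - 1 - m))"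
          unfolding szego_coeffs_def 1 dd by (simp add: algebra_simps)
        then show ?thesis using 3 m by (simp add: h_def)
      qed (use m in \<open>auto simp: h_def szego_coeffs_def\<close>)
    qed
    show "h m (x(m := y)) y' = h m x y'" for x y y'
      by (auto simp: h_def)
    show "(\<integral>\<^sup>+y. F (h m x y) \<partial>lborel) * ennreal (d ^ e m) = (\<integral>\<^sup>+y. F y \<partial>lborel)"
      if F: "F \<in> borel_measurable borel" for F x
    proof -
      consider "m < n - 1 - m" | "m = n - 1 - m" | "n - 1 - m < m" by linarith
      then show ?thesis
      proof cases
        case 1
        then show ?thesis
          using nn_integral_affine_complex[of 1 F "- cnj a * cnj (x (n - 1 - m))"] F by (simp add: h_def e_def)
      next
        case 2
        have "h m x y = y - cnj a * cnj y" for y using 2 unfolding h_def by (metis less_irrefl)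
        moreover have "e m = 1" using 2 unfolding e_def by (metis less_irrefl)
        ultimately show ?thesis
          using nn_integral_conj_affine[of "cnj a" F] F a by (simp add: d_def)
      next
        case 3
        then show ?thesis
          using nn_integral_affine_complex[of "complex_of_real d" F "- cnj a * cnj (x (n - 1 - m))"] F d
          by (simp add: h_def e_def)
      qed
    qed
      note [measurable] = measurable_coordinate[OF m] measurable_compose[OF measurable_coordinate[OF m] borel_measurable_cnj]
       measurable_compose[OF measurable_coordinate[of "n - 1 - m" n] borel_measurable_cnj]
    have "n - 1 - m < n" using m by simp
    then show "(\<lambda>x. h m x (x m)) \<in> borel_measurable (lborel_pi n)"
      unfolding h_def by measurable
  qed (rule H)
  moreover have "(\<Prod>m<n. ennreal (d ^ e m)) = ennreal (d ^ n)"
  proof -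
    have "(\<Sum>m<n. e m) = (\<Sum>m<n. e (n - 1 - m))"
      by (rule sum.reindex_bij_witness[of _ "\<lambda>m. n - 1 - m" "\<lambda>m. n - 1 - m"]) auto
    then have "2 * (\<Sum>m<n. e m) = (\<Sum>m<n. e m + e (n - 1 - m))" by (simp add: sum.distrib)
    also have "\<dots> = (\<Sum>m<n. 2)" by (intro sum.cong) (auto simp: e_def)
    finally have "(\<Sum>m<n. e m) = n" by simp
    then show ?thesis
      using d by (simp add: prod_ennreal flip: power_sum)
  qed
  ultimately show ?thesis by (simp add: d_def)
qed

section \<open>Measurable choice of the roots\<close>

text \<open>
  By compactness, a root in \<open>K\<close> exists as soon as arbitrarily small values occur on
  \<open>K\<close>, and a countable dense subset of \<open>K\<close> detects them.
\<close>

lemma sets_root_in_compact: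
  assumes f: "measurable_poly M f" and deg: "\<And>x. x \<in> space M \<Longrightarrow> degree (f x) \<le> n"
    and K: "compact K"
  shows "{x \<in> space M. \<exists>z\<in>K. poly (f x) z = 0} \<in> sets M"
proof -
  obtain T where T: "countable T" "T \<subseteq> K" "K \<subseteq> closure T"
    using separable[of K] by metis
  have "(\<exists>z\<in>K. poly p z = 0) \<longleftrightarrow> (\<forall>m::nat. \<exists>q\<in>T. cmod (poly p q) < inverse (real (Suc m)))" for p
  proof
    assume "\<exists>z\<in>K. poly p z = 0"
    then obtain z where z: "z \<in> K" "poly p z = 0" by auto
    show "\<forall>m::nat. \<exists>q\<in>T. cmod (poly p q) < inverse (real (Suc m))"
    proof
      fix m :: nat
      let ?U = "{w. cmod (poly p w) < inverse (real (Suc m))}"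
      have "open ?U" by (intro open_Collect_less continuous_intros)
      moreover have "z \<in> ?U" using z by simp
      ultimately have "?U \<inter> T \<noteq> {}"
        using z(1) T(3) open_Int_closure_eq_empty[of ?U T] by blast
      then show "\<exists>q\<in>T. cmod (poly p q) < inverse (real (Suc m))" by auto
    qed
  next
    assume *: "\<forall>m::nat. \<exists>q\<in>T. cmod (poly p q) < inverse (real (Suc m))"
    then have "K \<noteq> {}" using T by auto
    moreover have "continuous_on K (\<lambda>z. cmod (poly p z))" by (intro continuous_intros)
    ultimately obtain z where z: "z \<in> K" "\<And>w. w \<in> K \<Longrightarrow> cmod (poly p z) \<le> cmod (poly p w)"
      using continuous_attains_inf[OF K] by metis
    have "poly p z = 0"
    proof (rule ccontr)
      assume "poly p z \<noteq> 0"
      then obtain m where m: "inverse (real (Suc m)) < cmod (poly p z)"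
        using reals_Archimedean[of "cmod (poly p z)"] by auto
      obtain q where "q \<in> T" "cmod (poly p q) < inverse (real (Suc m))" using * by blast
      then show False using z(2)[of q] T(2) m by auto
    qed
    then show "\<exists>z\<in>K. poly p z = 0" using z by auto
  qed
  then have "{x \<in> space M. \<exists>z\<in>K. poly (f x) z = 0}
      = {x \<in> space M. \<forall>m::nat. \<exists>q\<in>T. cmod (poly (f x) q) < inverse (real (Suc m))}" by simp
  also have "\<dots> \<in> sets M"
  proof -
    have [measurable]: "(\<lambda>x. poly (f x) q) \<in> borel_measurable M" for q
      by (rule borel_measurable_poly_eval[OF f deg]) auto
    show ?thesis
      using T(1) by measurable
  qed
  finally show ?thesis .
qed

lemma sets_root_in_closed:
  assumes f: "measurable_poly M f" and deg: "\<And>x. x \<in> space M \<Longrightarrow> degree (f x) \<le> n"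
    and K: "closed K"
  shows "{x \<in> space M. \<exists>z\<in>K. poly (f x) z = 0} \<in> sets M"
proof -
  have "{x \<in> space M. \<exists>z\<in>K. poly (f x) z = 0}
      = (\<Union>k::nat. {x \<in> space M. \<exists>z\<in>K \<inter> cball 0 (real k). poly (f x) z = 0})"
  proof (intro equalityI subsetI)
    fix x assume "x \<in> {x \<in> space M. \<exists>z\<in>K. poly (f x) z = 0}"
    then obtain z where "x \<in> space M" "z \<in> K" "poly (f x) z = 0" by auto
    moreover obtain k :: nat where "cmod z \<le> real k" using real_arch_simple by blast
    ultimately show "x \<in> (\<Union>k::nat. {x \<in> space M. \<exists>z\<in>K \<inter> cball 0 (real k). poly (f x) z = 0})"
      by (auto intro!: exI[of _ k] bexI[of _ z])
  qed auto
  also have "\<dots> \<in> sets M"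
    by (intro sets.countable_UN image_subsetI sets_root_in_compact[OF f deg] closed_Int_compact K) auto
  finally show ?thesis .
qed

text \<open>
  The lexicographically smallest root is selected: smallest real part \<open>u\<close>, then smallest
  imaginary part \<open>v\<close>.
\<close>

lemma measurable_root_selection:
  assumes f: "measurable_poly M f" and deg: "\<And>x. x \<in> space M \<Longrightarrow> degree (f x) = n" and n: "n > 0"
  obtains r where "r \<in> borel_measurable M" "\<And>x. x \<in> space M \<Longrightarrow> poly (f x) (r x) = 0"
proof -
  define Z where "Z x = {z. poly (f x) z = 0}" for x
  have fin: "finite (Z x)" and ne: "Z x \<noteq> {}" if "x \<in> space M" for x
  proof -
    have "f x \<noteq> 0" using deg[OF that] n by auto
    then show "finite (Z x)" unfolding Z_def by (rule poly_roots_finite)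
    have nc: "\<not> constant (poly (f x))" using deg[OF that] n by (simp add: constant_degree)
    obtain z where "poly (f x) z = 0"
      using Fundamental_Theorem_Algebra.fundamental_theorem_of_algebra[OF nc] by (elim exE)
    then show "Z x \<noteq> {}" by (auto simp: Z_def)
  qed
  define u where "u x = Min (Re ` Z x)" for x
  define v where "v x = Min (Im ` {z \<in> Z x. Re z = u x})" for x
  have u_in: "\<exists>z\<in>Z x. Re z = u x" if "x \<in> space M" for x
  proof -
    have "u x \<in> Re ` Z x" unfolding u_def using fin[OF that] ne[OF that] by (intro Min_in) auto
    then show ?thesis by auto
  qed
  have u_le: "u x \<le> Re z" if "x \<in> space M" "z \<in> Z x" for x z
    unfolding u_def using fin[OF that(1)] that by (intro Min_le) auto
  have root: "Complex (u x) (v x) \<in> Z x" if x: "x \<in> space M" for x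
  proof -
    have "v x \<in> Im ` {z \<in> Z x. Re z = u x}"
      unfolding v_def using fin[OF x] u_in[OF x] by (intro Min_in) auto
    then obtain z where "z \<in> Z x" "Re z = u x" "Im z = v x" by auto
    then have "z = Complex (u x) (v x)" by (simp add: complex_eq_iff)
    then show ?thesis using \<open>z \<in> Z x\<close> by simp
  qed
  have deg_le: "\<And>x. x \<in> space M \<Longrightarrow> degree (f x) \<le> n" using deg by simp
  have u_meas [measurable]: "u \<in> borel_measurable M"
  proof (rule borel_measurableI_le)
    fix t
    have "{x \<in> space M. u x \<le> t} = {x \<in> space M. \<exists>z\<in>{z. Re z \<le> t}. poly (f x) z = 0}"
    proof (intro Collect_cong conj_cong refl iffI)
      fix x assume x: "x \<in> space M"
      show "\<exists>z\<in>{z. Re z \<le> t}. poly (f x) z = 0" if "u x \<le> t"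
        using u_in[OF x] that unfolding Z_def by force
      show "u x \<le> t" if "\<exists>z\<in>{z. Re z \<le> t}. poly (f x) z = 0"
        using that u_le[OF x] by (force simp: Z_def)
    qed
    also have "\<dots> \<in> sets M"
      by (intro sets_root_in_closed[OF f deg_le] closed_Collect_le continuous_intros)
    finally show "{x \<in> space M. u x \<le> t} \<in> sets M" .
  qed
  have v_meas [measurable]: "v \<in> borel_measurable M"
  proof (rule borel_measurableI_le)
    fix t
    \<comment> \<open>\<open>B q\<close> avoids any reference to \<open>u\<close>: as there are finitely many roots, a root with real part \<open>u x\<close> and
      imaginary part at most \<open>t\<close> exists iff for all rational \<open>q > u x\<close> one exists with real part at most \<open>q\<close>.\<close>
    define B where "B q = {x \<in> space M. \<exists>z\<in>{z. Re z \<le> q \<and> Im z \<le> t}. poly (f x) z = 0}" for q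
    have B: "B q \<in> sets M" for q
      unfolding B_def
      by (intro sets_root_in_closed[OF f deg_le] closed_Collect_conj closed_Collect_le continuous_intros)
    have "{x \<in> space M. v x \<le> t} = {x \<in> space M. \<forall>q\<in>\<rat>. q \<le> u x \<or> x \<in> B q}"
    proof (intro Collect_cong conj_cong refl iffI)
      fix x assume x: "x \<in> space M"
      show "\<forall>q\<in>\<rat>. q \<le> u x \<or> x \<in> B q" if "v x \<le> t"
        using root[OF x] that x by (auto simp: B_def Z_def intro!: exI[of _ "Complex (u x) (v x)"])
      show "v x \<le> t" if *: "\<forall>q\<in>\<rat>. q \<le> u x \<or> x \<in> B q"
      proof -
        define S where "S = Re ` {z \<in> Z x. u x < Re z}"
        have finS: "finite S" using fin[OF x] by (simp add: S_def)
        obtain q where q: "q \<in> \<rat>" "u x < q" "\<And>s. s \<in> S \<Longrightarrow> q < s"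
        proof (cases "S = {}")
          case True
          obtain q where "q \<in> \<rat>" "u x < q" "q < u x + 1" using Rats_dense_in_real[of "u x" "u x + 1"] by auto
          with True that show ?thesis by auto
        next
          case False
          then have "u x < Min S" using finS by (auto simp: S_def)
          then obtain q where "q \<in> \<rat>" "u x < q" "q < Min S" using Rats_dense_in_real by metis
          with finS False that show ?thesis by auto
        qed
        then obtain z where z: "Re z \<le> q" "Im z \<le> t" "z \<in> Z x" using * by (force simp: B_def Z_def)
        have "Re z = u x"
        proof (rule ccontr)
          assume "Re z \<noteq> u x"
          then have "Re z \<in> S" using u_le[OF x z(3)] z(3) by (auto simp: S_def)
          then show False using q(3) z(1) by force
        qed
        then have "v x \<le> Im z" unfolding v_def using fin[OF x] z by (intro Min_le) auto
        then show ?thesis using z by simp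
      qed
    qed
    also have "\<dots> \<in> sets M"
      using B countable_rat by measurable
    finally show "{x \<in> space M. v x \<le> t} \<in> sets M" .
  qed
  show ?thesis
  proof (rule that)
    have "(\<lambda>x. complex_of_real (u x) + \<i> * complex_of_real (v x)) \<in> borel_measurable M" by measurable
    then show "(\<lambda>x. Complex (u x) (v x)) \<in> borel_measurable M" by (simp add: Complex_eq)
    show "poly (f x) (Complex (u x) (v x)) = 0" if "x \<in> space M" for x
      using root[OF that] by (simp add: Z_def)
  qed
qed

text \<open>
  Select a root, divide by its linear factor with Horner's scheme, and continue with the quotient.
\<close>

lemma measurable_factorization:
  obtains \<rho> where "\<rho> \<in> measurable (lborel_pi n) (lborel_pi n)"
    "\<And>c. c \<in> space (lborel_pi n) \<Longrightarrow> monic_poly n c = root_poly n (\<rho> c)"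
proof -
  have "\<exists>\<rho> \<in> measurable (lborel_pi n) (lborel_pi n). \<forall>c\<in>space (lborel_pi n). monic_poly n c = root_poly n (\<rho> c)"
  proof (induction n)
    case 0
    show ?case by (intro bexI[of _ "\<lambda>c. c"]) auto
  next
    case (Suc n)
    then obtain \<rho> where \<rho>: "\<rho> \<in> measurable (lborel_pi n) (lborel_pi n)"
      "\<And>c. c \<in> space (lborel_pi n) \<Longrightarrow> monic_poly n c = root_poly n (\<rho> c)" by auto
    have mon: "measurable_poly (lborel_pi (Suc n)) (\<lambda>c. monic_poly m c)" if "m \<le> Suc n" for m
      using that by (intro measurable_poly_monic_poly measurable_coordinate) auto
    obtain r where r: "r \<in> borel_measurable (lborel_pi (Suc n))"
      "\<And>c. c \<in> space (lborel_pi (Suc n)) \<Longrightarrow> poly (monic_poly (Suc n) c) (r c) = 0"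
      using measurable_root_selection[OF mon[of "Suc n"], of "Suc n"] by (auto simp: monic_poly_monic simp del: monic_poly.simps)
    define d where "d c = (\<lambda>i\<in>{..<n}. horner (r c) c i)" for c
    have d: "d \<in> measurable (lborel_pi (Suc n)) (lborel_pi n)"
      unfolding d_def horner_def
    proof (rule measurable_restrict)
      fix i assume "i \<in> {..<n}"
      then show "(\<lambda>c. poly (monic_poly (Suc i) c) (r c)) \<in> measurable (lborel_pi (Suc n)) lborel"
        using borel_measurable_poly_eval[OF mon[of "Suc i"] _ r(1), of "Suc i"]
        by (simp add: monic_poly_monic del: monic_poly.simps)
    qed
    define \<sigma> where "\<sigma> c = (\<rho> (d c))(n := r c)" for c
    have "\<sigma> \<in> measurable (lborel_pi (Suc n)) (lborel_pi (Suc n))"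
      unfolding \<sigma>_def using r(1)
      by (intro measurable_fun_upd[of _ "{..<n}"] measurable_compose[OF d \<rho>(1)]) auto
    moreover have "monic_poly (Suc n) c = root_poly (Suc n) (\<sigma> c)" if c: "c \<in> space (lborel_pi (Suc n))" for c
    proof -
      have "c n = - (r c * poly (monic_poly n c) (r c))"
        using r(2)[OF c] by (simp add: add_eq_0_iff2)
      then have "monic_poly (Suc n) c = monic_poly n (horner (r c) c) * [:- r c, 1:]"
        unfolding mult.commute[of _ "[:- r c, 1:]"] horner_division by simp
      also have "monic_poly n (horner (r c) c) = monic_poly n (d c)"
        by (rule monic_poly_cong) (simp add: d_def)
      also have "\<dots> = root_poly n (\<rho> (d c))"
        by (rule \<rho>(2)[OF measurable_space[OF d c]])
      also have "\<dots> * [:- r c, 1:] = root_poly (Suc n) (\<sigma> c)"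
        unfolding prod.lessThan_Suc by (intro arg_cong2[where f = "(*)"] prod.cong) (auto simp: \<sigma>_def)
      finally show ?thesis .
    qed
    ultimately show ?case by blast
  qed
  then show ?thesis using that by blast
qed

text \<open>
  The events for unordered collections are defined through ordered tuples, so the roots are ordered
  first.
\<close>

lemma measurable_proots:
  "(\<lambda>c. proots (monic_poly n c)) \<in> measurable (lborel_pi n) (unordered_space n)"
proof -
  obtain \<rho> where \<rho>: "\<rho> \<in> measurable (lborel_pi n) (lborel_pi n)"
    "\<And>c. c \<in> space (lborel_pi n) \<Longrightarrow> monic_poly n c = root_poly n (\<rho> c)"
    using measurable_factorization[of n] by blast
  have "(\<lambda>c. unordered n (\<rho> c)) \<in> measurable (lborel_pi n) (unordered_space n)"
    by (rule measurable_compose[OF \<rho>(1) measurable_unordered])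
  also have "?this \<longleftrightarrow> ?thesis"
    by (intro measurable_cong) (simp add: \<rho>(2) proots_root_poly unordered_def)
  finally show ?thesis .
qed

text \<open>
  The density of the coefficients of the random Szego polynomial for \<open>s = \<beta> / 2 -
  1\<close>, up to a constant.
\<close>

definition stable_weight :: "real \<Rightarrow> complex poly \<Rightarrow> ennreal" where
  "stable_weight s p = (if stable p then ennreal (schur_resultant p powr s) else 0)"

lemma stable_weight_root_poly:
  "stable_weight s (root_poly n z) =
    (if \<forall>j<n. cmod (z j) < 1 then ennreal ((\<Prod>j<n. \<Prod>k<n. cmod (1 - z j * cnj (z k))) powr s) else 0)"
  unfolding stable_weight_def stable_root_poly schur_resultant_root_poly ..

lemma measurable_stable_weight:
  "(\<lambda>c. stable_weight s (monic_poly n c)) \<in> borel_measurable (lborel_pi n)"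
proof -
  obtain \<rho> where \<rho>: "\<rho> \<in> measurable (lborel_pi n) (lborel_pi n)"
    "\<And>c. c \<in> space (lborel_pi n) \<Longrightarrow> monic_poly n c = root_poly n (\<rho> c)"
    using measurable_factorization[of n] by blast
  have comp: "(\<lambda>c. \<rho> c i) \<in> borel_measurable (lborel_pi n)" if "i < n" for i
    using measurable_compose[OF \<rho>(1) measurable_coordinate[OF that]] .
  have 1: "Measurable.pred (lborel_pi n) (\<lambda>c. \<forall>j<n. cmod (\<rho> c j) < 1)"
  proof -
    have "Measurable.pred (lborel_pi n) (\<lambda>c. cmod (\<rho> c j) < 1)" if "j < n" for j
    proof -
      note [measurable] = comp[OF that]
      show ?thesis by measurable
    qed
    then have "Measurable.pred (lborel_pi n) (\<lambda>c. \<forall>j\<in>{..<n}. cmod (\<rho> c j) < 1)"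
      by (rule pred_intros_finite(3)[OF finite_lessThan]) simp
    then show ?thesis by (simp only: Ball_def lessThan_iff)
  qed
  have 2: "(\<lambda>c. (\<Prod>j<n. \<Prod>k<n. cmod (1 - \<rho> c j * cnj (\<rho> c k)))) \<in> borel_measurable (lborel_pi n)"
  proof (intro borel_measurable_prod)
    fix j k assume "j \<in> {..<n}" "k \<in> {..<n}"
    then have [measurable]: "(\<lambda>c. \<rho> c j) \<in> borel_measurable (lborel_pi n)"
        "(\<lambda>c. cnj (\<rho> c k)) \<in> borel_measurable (lborel_pi n)"
      using measurable_compose[OF comp borel_measurable_cnj] comp by auto
    show "(\<lambda>c. cmod (1 - \<rho> c j * cnj (\<rho> c k))) \<in> borel_measurable (lborel_pi n)"
      by measurable
  qed
  have pw: "(\<lambda>x::real. ennreal (x powr s)) \<in> borel_measurable borel" by measurable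
  have "(\<lambda>c. stable_weight s (root_poly n (\<rho> c))) \<in> borel_measurable (lborel_pi n)"
    unfolding stable_weight_root_poly
    by (intro measurable_If measurable_compose[OF 2 pw] measurable_const predE[OF 1]) simp
  also have "?this \<longleftrightarrow> ?thesis"
    by (intro measurable_cong) (simp add: \<rho>(2))
  finally show ?thesis .
qed

section \<open>The law of the coefficients of a Szego polynomial\<close>

lemma nn_integral_neg_cnj:
  fixes F :: "complex \<Rightarrow> ennreal"
  assumes F: "F \<in> borel_measurable borel"
  shows "(\<integral>\<^sup>+a. F (- cnj a) \<partial>lborel) = (\<integral>\<^sup>+u. F u \<partial>lborel)"
proof -
  let ?g = "\<lambda>a. - cnj a"
  have lin: "bounded_linear ?g"
    by (intro bounded_linear_minus bounded_linear_cnj)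
  then have g: "?g \<in> borel_measurable borel"
    by (intro borel_measurable_continuous_onI linear_continuous_on)
  have U: "?g ` UNIV = UNIV"
    by (rule surjI[of _ ?g]) simp
  have "(\<integral>\<^sup>+x. F (?g x) * ennreal \<bar>Re (?g 1) * Im (?g \<i>) - Re (?g \<i>) * Im (?g 1)\<bar> * indicator UNIV x \<partial>lborel)
      = (\<integral>\<^sup>+y. F y * indicator (?g ` UNIV) y \<partial>lborel)"
    by (rule nn_integral_substitution_complex[where h = ?g])
       (use g F in \<open>auto simp: U intro: bounded_linear_imp_has_derivative[OF lin]\<close>)
  then show ?thesis unfolding U by simp
qed

lemma stable_weight_szego_step:
  assumes p: "degree p = n" "coeff p n = 1" and a: "cmod a < 1"
  shows "stable_weight s (szego_step a p) = ennreal ((1 - (cmod a)\<^sup>2) powr (real (Suc n) * s)) * stable_weight s p"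
proof -
  have d: "1 - (cmod a)\<^sup>2 > 0" using a by (simp add: abs_square_less_1)
  have "schur_resultant (szego_step a p) powr s = ((1 - (cmod a)\<^sup>2) ^ Suc n) powr s * schur_resultant p powr s"
    unfolding schur_resultant_szego_step[OF p a] by (rule powr_mult)
  also have "((1 - (cmod a)\<^sup>2) ^ Suc n) powr s = (1 - (cmod a)\<^sup>2) powr (real (Suc n) * s)"
    using d by (simp only: powr_realpow[symmetric] powr_powr)
  finally show ?thesis
    unfolding stable_weight_def stable_szego_step[OF p a] by (simp add: ennreal_mult')
qed

text \<open>
  The exponent splits as \<open>(\<beta>/2)(n + 1) - 1 = n + (n + 1)(\<beta>/2 - 1)\<close>: the first
  part is the Jacobian of the step, the second one the growth of the resultant.
\<close>

lemma verblunsky_weight: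
  assumes p: "degree p = n" "coeff p n = 1"
  shows "verblunsky_density \<beta> n a * stable_weight (\<beta> / 2 - 1) p
    = ennreal (\<beta> * real (n + 1) / (2 * pi)) *
      (ennreal ((1 - (cmod a)\<^sup>2) ^ n) * indicator (ball 0 1) a * stable_weight (\<beta> / 2 - 1) (szego_step a p))"
proof (cases "cmod a < 1")
  case True
  then have d: "1 - (cmod a)\<^sup>2 > 0" by (simp add: abs_square_less_1)
  have "(1 - (cmod a)\<^sup>2) powr (\<beta> / 2 * real (n + 1) - 1)
      = (1 - (cmod a)\<^sup>2) powr (real n) * (1 - (cmod a)\<^sup>2) powr (real (Suc n) * (\<beta> / 2 - 1))"
    unfolding powr_add[symmetric] by (simp add: algebra_simps)
  also have "(1 - (cmod a)\<^sup>2) powr (real n) = (1 - (cmod a)\<^sup>2) ^ n"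
    using d by (rule powr_realpow)
  finally have *: "(1 - (cmod a)\<^sup>2) powr (\<beta> / 2 * real (n + 1) - 1)
      = (1 - (cmod a)\<^sup>2) ^ n * (1 - (cmod a)\<^sup>2) powr (real (Suc n) * (\<beta> / 2 - 1))" .
  have split: "ennreal (u * (v * w)) = ennreal u * (ennreal v * ennreal w)" if "v \<ge> 0" "w \<ge> 0" for u v w
    using that by (simp add: ennreal_mult'')
  have "verblunsky_density \<beta> n a = ennreal (\<beta> * real (n + 1) / (2 * pi)) * (ennreal ((1 - (cmod a)\<^sup>2) ^ n)
      * ennreal ((1 - (cmod a)\<^sup>2) powr (real (Suc n) * (\<beta> / 2 - 1))))"
    unfolding verblunsky_density_def * using True d by (subst split) auto
  then show ?thesis
    using True unfolding stable_weight_szego_step[OF p True] by (simp add: mult_ac)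
qed (simp add: verblunsky_density_def)

lemma measurable_verblunsky_density [measurable]: "verblunsky_density \<beta> k \<in> borel_measurable borel"
proof -
  have [measurable]: "ball 0 1 \<in> sets (borel :: complex measure)" by simp
  show ?thesis unfolding verblunsky_density_def by measurable
qed

text \<open>
  Induction on the degree. By \<open>verblunsky_weight\<close> the density of the new Verblunsky
  coefficient turns the weight of the old polynomial into the weight of the new one, times the
  Jacobian of \<open>szego_coeffs\<close>. The integral over \<open>a\<close> then becomes the
  integral over the constant coefficient \<open>- cnj a\<close>, and its restriction to the disc is
  implied by stability.
\<close>

lemma nn_integral_szego:
  fixes G :: "complex poly \<Rightarrow> ennreal" and \<beta> :: real
  defines "N \<equiv> (\<lambda>k. density lborel (verblunsky_density \<beta> k))" and "s \<equiv> \<beta> / 2 - 1"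
  assumes "(\<lambda>c. G (monic_poly n c)) \<in> borel_measurable (lborel_pi n)"
  shows "(\<integral>\<^sup>+\<alpha>. G (szego \<alpha> n) \<partial>PiM {..<n} N)
    = (\<Prod>k<n. ennreal (\<beta> * real (k + 1) / (2 * pi))) * (\<integral>\<^sup>+c. G (monic_poly n c) * stable_weight s (monic_poly n c) \<partial>lborel_pi n)"
proof -
  interpret N: product_sigma_finite N
  proof (rule product_sigma_finite.intro)
    fix k
    have "AE a in lborel. verblunsky_density \<beta> k a \<noteq> \<infinity>"
      by (simp add: verblunsky_density_def indicator_def)
    then show "sigma_finite_measure (N k)"
      unfolding N_def by (subst sigma_finite_measure.sigma_finite_iff_density_finite[OF sigma_finite_lborel]) auto
  qed
  show ?thesis
    using assms(3)
  proof (induction n arbitrary: G)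
    case 0
    have "schur_resultant 1 = 1" by (simp add: schur_resultant_def)
    then show ?case
      by (simp add: PiM_empty emeasure_count_space stable_weight_def stable_def)
  next
    case (Suc n)
    note G = Suc.prems
    have setsN: "sets (N k) = sets borel" for k by (simp add: N_def)
    have sets_PiN: "sets (PiM {..<m} N) = sets (lborel_pi m)" for m
      by (intro sets_PiM_cong) (auto simp: N_def)
    interpret S: sigma_finite_measure "lborel_pi n"
      by (rule lborel_product.sigma_finite) simp
    interpret PS: pair_sigma_finite "lborel_pi n" "lborel :: complex measure" ..
    define b where "b = ennreal (\<beta> * real (n + 1) / (2 * pi))"
    define q where "q = verblunsky_density \<beta> n"
    have q_meas [measurable]: "q \<in> borel_measurable borel" unfolding q_def by measurable
    define W where "W = stable_weight s"
    \<comment> \<open>The Jacobian of \<open>szego_coeffs a n\<close>, cut off outside the disc.\<close>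
    define D where "D a = ennreal ((1 - (cmod a)\<^sup>2) ^ n) * indicator (ball 0 1) a" for a :: complex
    have [measurable]: "ball 0 1 \<in> sets (borel :: complex measure)" by simp
    have D_meas [measurable]: "D \<in> borel_measurable borel" unfolding D_def by measurable
    have step_meas: "(\<lambda>x. H (szego_step (snd x) (monic_poly n (fst x)))) \<in> borel_measurable (lborel_pi n \<Otimes>\<^sub>M lborel)"
      if "(\<lambda>c. H (monic_poly (Suc n) c)) \<in> borel_measurable (lborel_pi (Suc n))" for H :: "complex poly \<Rightarrow> ennreal"
      by (rule measurable_monic[OF measurable_poly_szego_step[where n = n] _ that])
         (auto intro!: measurable_poly_monic_poly measurable_fst_coordinate simp: monic_poly_monic szego_step_monic)
    have step_meas1: "(\<lambda>a. G (szego_step a p)) \<in> borel_measurable borel" if p: "degree p = n" "coeff p n = 1" for p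
    proof -
      have "(\<lambda>a. (coeffs_of n p, a)) \<in> measurable borel (lborel_pi n \<Otimes>\<^sub>M lborel)"
        by (auto simp: space_PiM coeffs_of_def)
      from measurable_compose[OF this step_meas[OF G]] show ?thesis
        by (simp add: monic_poly_coeffs_of[OF p])
    qed
    have GW: "(\<lambda>c. (\<lambda>p. G p * W p) (monic_poly (Suc n) c)) \<in> borel_measurable (lborel_pi (Suc n))"
      using G measurable_stable_weight[of s "Suc n"] unfolding W_def by (intro borel_measurable_times_ennreal)
    have ins: "{..<Suc n} = insert n {..<n}" by auto
    have szego_meas: "(\<lambda>\<alpha>. G (szego \<alpha> (Suc n))) \<in> borel_measurable (PiM {..<Suc n} N)"
    proof (rule measurable_monic[OF measurable_poly_szego _ G])
      show "(\<lambda>x. x i) \<in> borel_measurable (PiM {..<Suc n} N)" if "i < Suc n" for i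
        using measurable_component_singleton[of i "{..<Suc n}" N] that
        by (simp add: measurable_cong_sets[OF refl setsN])
    qed (simp add: szego_monic del: szego.simps)
    have "(\<integral>\<^sup>+\<alpha>. G (szego \<alpha> (Suc n)) \<partial>PiM {..<Suc n} N)
        = (\<integral>\<^sup>+\<alpha>. (\<integral>\<^sup>+a. G (szego (\<alpha>(n := a)) (Suc n)) \<partial>N n) \<partial>PiM {..<n} N)"
      using szego_meas unfolding ins by (intro N.product_nn_integral_insert) auto
    also have "\<dots> = (\<integral>\<^sup>+\<alpha>. (\<integral>\<^sup>+a. q a * G (szego_step a (szego \<alpha> n)) \<partial>lborel) \<partial>PiM {..<n} N)"
    proof (rule nn_integral_cong)
      fix \<alpha> :: "nat \<Rightarrow> complex"
      have "szego (\<alpha>(n := a)) n = szego \<alpha> n" for a by (rule szego_cong) simp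
      then show "(\<integral>\<^sup>+a. G (szego (\<alpha>(n := a)) (Suc n)) \<partial>N n) = (\<integral>\<^sup>+a. q a * G (szego_step a (szego \<alpha> n)) \<partial>lborel)"
        unfolding N_def using step_meas1[of "szego \<alpha> n"]
        by (subst nn_integral_density) (auto simp: szego_monic q_def)
    qed
    also have "\<dots> = (\<Prod>k<n. ennreal (\<beta> * real (k + 1) / (2 * pi))) *
        (\<integral>\<^sup>+c. (\<integral>\<^sup>+a. q a * G (szego_step a (monic_poly n c)) \<partial>lborel) * stable_weight s (monic_poly n c) \<partial>lborel_pi n)"
    proof (rule Suc.IH)
      have "(\<lambda>x. q (snd x) * G (szego_step (snd x) (monic_poly n (fst x)))) \<in> borel_measurable (lborel_pi n \<Otimes>\<^sub>M lborel)"
        using step_meas[OF G] by measurable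
      then show "(\<lambda>c. \<integral>\<^sup>+a. q a * G (szego_step a (monic_poly n c)) \<partial>lborel) \<in> borel_measurable (lborel_pi n)"
        by (intro sigma_finite_measure.borel_measurable_nn_integral[OF sigma_finite_lborel]) (simp add: case_prod_unfold)
    qed
    also have "(\<integral>\<^sup>+c. (\<integral>\<^sup>+a. q a * G (szego_step a (monic_poly n c)) \<partial>lborel) * stable_weight s (monic_poly n c) \<partial>lborel_pi n)
        = (\<integral>\<^sup>+c. (\<integral>\<^sup>+a. b * (D a * (G (szego_step a (monic_poly n c)) * W (szego_step a (monic_poly n c)))) \<partial>lborel) \<partial>lborel_pi n)"
    proof (rule nn_integral_cong)
      fix c :: "nat \<Rightarrow> complex"
      have "(\<integral>\<^sup>+a. q a * G (szego_step a (monic_poly n c)) \<partial>lborel) * stable_weight s (monic_poly n c)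
          = (\<integral>\<^sup>+a. q a * G (szego_step a (monic_poly n c)) * stable_weight s (monic_poly n c) \<partial>lborel)"
        using step_meas1[OF monic_poly_monic] by (intro nn_integral_multc[symmetric]) measurable
      also have "\<dots> = (\<integral>\<^sup>+a. b * (D a * (G (szego_step a (monic_poly n c)) * W (szego_step a (monic_poly n c)))) \<partial>lborel)"
      proof (rule nn_integral_cong)
        fix a :: complex
        have "q a * G (szego_step a (monic_poly n c)) * stable_weight s (monic_poly n c)
            = (q a * stable_weight s (monic_poly n c)) * G (szego_step a (monic_poly n c))"
          by (simp only: mult_ac)
        also have "\<dots> = b * (D a * (G (szego_step a (monic_poly n c)) * W (szego_step a (monic_poly n c))))"
          unfolding q_def s_def W_def verblunsky_weight[OF monic_poly_monic] b_def D_def by (simp only: mult_ac)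
        finally show "q a * G (szego_step a (monic_poly n c)) * stable_weight s (monic_poly n c)
            = b * (D a * (G (szego_step a (monic_poly n c)) * W (szego_step a (monic_poly n c))))" .
      qed
      finally show "(\<integral>\<^sup>+a. q a * G (szego_step a (monic_poly n c)) \<partial>lborel) * stable_weight s (monic_poly n c)
          = (\<integral>\<^sup>+a. b * (D a * (G (szego_step a (monic_poly n c)) * W (szego_step a (monic_poly n c)))) \<partial>lborel)" .
    qed
    also have "\<dots> = (\<integral>\<^sup>+a. (\<integral>\<^sup>+c. b * (D a * (G (szego_step a (monic_poly n c)) * W (szego_step a (monic_poly n c)))) \<partial>lborel_pi n) \<partial>lborel)"
    proof (rule PS.Fubini'[symmetric])
      show "(\<lambda>(c, a). b * (D a * (G (szego_step a (monic_poly n c)) * W (szego_step a (monic_poly n c)))))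
          \<in> borel_measurable (lborel_pi n \<Otimes>\<^sub>M lborel)"
        using step_meas[OF GW] unfolding case_prod_unfold by measurable
    qed
    \<comment> \<open>For fixed \<open>a\<close>, pass from the old coefficients to the new ones; the Jacobian cancels.\<close>
    also have "\<dots> = (\<integral>\<^sup>+a. b * (indicator (ball 0 1) a *
        (\<integral>\<^sup>+d. G (monic_poly (Suc n) (d(n := - cnj a))) * W (monic_poly (Suc n) (d(n := - cnj a))) \<partial>lborel_pi n)) \<partial>lborel)"
    proof (rule nn_integral_cong)
      fix a :: complex
      let ?H = "\<lambda>d. G (monic_poly (Suc n) (d(n := - cnj a))) * W (monic_poly (Suc n) (d(n := - cnj a)))"
      have "(\<lambda>d. d(n := - cnj a)) \<in> measurable (lborel_pi n) (lborel_pi (Suc n))"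
        by (rule measurable_fun_upd[of _ "{..<n}"]) auto
      from measurable_compose[OF this GW] have H: "?H \<in> borel_measurable (lborel_pi n)" .
      have pair: "(\<lambda>c. (c, a)) \<in> measurable (lborel_pi n) (lborel_pi n \<Otimes>\<^sub>M lborel)" by measurable
      have Hs: "(\<lambda>c. G (szego_step a (monic_poly n c)) * W (szego_step a (monic_poly n c))) \<in> borel_measurable (lborel_pi n)"
        using measurable_compose[OF pair step_meas[OF GW]] by simp
      have eq: "G (szego_step a (monic_poly n c)) * W (szego_step a (monic_poly n c)) = ?H (\<lambda>i\<in>{..<n}. szego_coeffs a n c i)" for c
      proof -
        have "szego_step a (monic_poly n c) = monic_poly (Suc n) ((\<lambda>i\<in>{..<n}. szego_coeffs a n c i)(n := - cnj a))"
          unfolding szego_step_monic_poly by (rule monic_poly_cong) auto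
        then show ?thesis by simp
      qed
      have "(\<integral>\<^sup>+c. b * (D a * (G (szego_step a (monic_poly n c)) * W (szego_step a (monic_poly n c)))) \<partial>lborel_pi n)
          = b * (D a * (\<integral>\<^sup>+c. G (szego_step a (monic_poly n c)) * W (szego_step a (monic_poly n c)) \<partial>lborel_pi n))"
        using Hs by (simp add: nn_integral_cmult)
      also have "\<dots> = b * (indicator (ball 0 1) a * (\<integral>\<^sup>+d. ?H d \<partial>lborel_pi n))"
      proof (cases "cmod a < 1")
        case True
        show ?thesis
          using nn_integral_szego_coeffs[OF True H] True unfolding eq by (simp add: D_def mult_ac)
      qed (simp add: D_def)
      finally show "(\<integral>\<^sup>+c. b * (D a * (G (szego_step a (monic_poly n c)) * W (szego_step a (monic_poly n c)))) \<partial>lborel_pi n)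
          = b * (indicator (ball 0 1) a * (\<integral>\<^sup>+d. ?H d \<partial>lborel_pi n))" .
    qed
    also have "\<dots> = b * (\<integral>\<^sup>+u. indicator (ball 0 1) u *
        (\<integral>\<^sup>+d. G (monic_poly (Suc n) (d(n := u))) * W (monic_poly (Suc n) (d(n := u))) \<partial>lborel_pi n) \<partial>lborel)"
      (is "_ = b * (\<integral>\<^sup>+u. ?F u \<partial>lborel)")
    proof -
      have "(\<lambda>p. (snd p)(n := fst p)) \<in> measurable (lborel \<Otimes>\<^sub>M lborel_pi n) (lborel_pi (Suc n))"
        by (rule measurable_fun_upd[of _ "{..<n}"]) auto
      from measurable_compose[OF this GW]
      have "(\<lambda>u. \<integral>\<^sup>+d. G (monic_poly (Suc n) (d(n := u))) * W (monic_poly (Suc n) (d(n := u))) \<partial>lborel_pi n) \<in> borel_measurable lborel"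
        by (intro S.borel_measurable_nn_integral) (simp only: case_prod_unfold)
      then have F: "?F \<in> borel_measurable borel" by simp
      then have F': "(\<lambda>a. ?F (- cnj a)) \<in> borel_measurable borel"
        by (rule measurable_compose[rotated]) (intro borel_measurable_continuous_onI continuous_intros)
      have "(\<integral>\<^sup>+a. b * (indicator (ball 0 1) a *
        (\<integral>\<^sup>+d. G (monic_poly (Suc n) (d(n := - cnj a))) * W (monic_poly (Suc n) (d(n := - cnj a))) \<partial>lborel_pi n)) \<partial>lborel)
        = (\<integral>\<^sup>+a. b * ?F (- cnj a) \<partial>lborel)"
        by (intro nn_integral_cong) (simp add: indicator_def)
      also have "\<dots> = b * (\<integral>\<^sup>+a. ?F (- cnj a) \<partial>lborel)"
        using F' by (intro nn_integral_cmult) simp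
      also have "(\<integral>\<^sup>+a. ?F (- cnj a) \<partial>lborel) = (\<integral>\<^sup>+u. ?F u \<partial>lborel)"
        by (rule nn_integral_neg_cnj[OF F])
      finally show ?thesis .
    qed
    also have "(\<integral>\<^sup>+u. ?F u \<partial>lborel) = (\<integral>\<^sup>+u. (\<integral>\<^sup>+d. G (monic_poly (Suc n) (d(n := u))) * W (monic_poly (Suc n) (d(n := u))) \<partial>lborel_pi n) \<partial>lborel)"
    proof (rule nn_integral_cong)
      fix u :: complex
      have "W (monic_poly (Suc n) (d(n := u))) = 0" if "\<not> cmod u < 1" for d
      proof -
        have "\<not> stable (monic_poly (Suc n) (d(n := u)))"
          using stable_const_coeff[OF monic_poly_monic, of n "d(n := u)"] that by auto
        then show ?thesis by (simp add: W_def stable_weight_def)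
      qed
      then show "?F u = (\<integral>\<^sup>+d. G (monic_poly (Suc n) (d(n := u))) * W (monic_poly (Suc n) (d(n := u))) \<partial>lborel_pi n)"
        by (cases "cmod u < 1") simp_all
    qed
    also have "\<dots> = (\<integral>\<^sup>+c. G (monic_poly (Suc n) c) * W (monic_poly (Suc n) c) \<partial>lborel_pi (Suc n))"
      using GW unfolding ins by (intro lborel_product.product_nn_integral_insert_rev[symmetric]) auto
    finally show ?case
      by (simp only: prod.lessThan_Suc b_def W_def mult_ac)
  qed
qed

section \<open>Tridiagonal determinants\<close>

definition tridiagonal :: "nat \<Rightarrow> (nat \<Rightarrow> complex) \<Rightarrow> (nat \<Rightarrow> complex) \<Rightarrow> complex mat" where
  "tridiagonal n d e = mat n n (\<lambda>(i, j). if i = j then d i else if j = Suc i then e i else if i = Suc j then e j else 0)"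

lemma tridiagonal_carrier [simp]: "tridiagonal n d e \<in> carrier_mat n n"
  "dim_row (tridiagonal n d e) = n" "dim_col (tridiagonal n d e) = n"
  by (auto simp: tridiagonal_def)

lemma det_tridiagonal_Suc_Suc:
  "det (tridiagonal (Suc (Suc m)) d e)
    = d (Suc m) * det (tridiagonal (Suc m) d e) - (e m)\<^sup>2 * det (tridiagonal m d e)"
proof -
  let ?T = "\<lambda>n. tridiagonal n d e"
  let ?A = "?T (Suc (Suc m))"
  let ?N = "mat_delete ?A (Suc m) m"
  have N: "?N \<in> carrier_mat (Suc m) (Suc m)"
    using mat_delete_carrier[of ?A "Suc (Suc m)" "Suc (Suc m)" "Suc m" m] by simp
  have D1: "mat_delete ?A (Suc m) (Suc m) = ?T (Suc m)"
    by (rule eq_matI) (auto simp: mat_delete_def tridiagonal_def)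
  have D2: "mat_delete ?N m m = ?T m"
    by (rule eq_matI) (auto simp: mat_delete_def tridiagonal_def)
  have Nm: "?N $$ (i, m) = (if i = m then e m else 0)" if "i < Suc m" for i
    using that by (auto simp: mat_delete_def tridiagonal_def)
  have "det ?N = (\<Sum>i<Suc m. ?N $$ (i, m) * cofactor ?N i m)"
    by (rule laplace_expansion_column[OF N]) simp
  also have "\<dots> = ?N $$ (m, m) * cofactor ?N m m"
    by (simp add: Nm)
  also have "\<dots> = e m * det (?T m)"
    by (simp add: Nm cofactor_def D2)
  finally have detN: "det ?N = e m * det (?T m)" .
  have "det ?A = (\<Sum>j<Suc (Suc m). ?A $$ (Suc m, j) * cofactor ?A (Suc m) j)"
    by (rule laplace_expansion_row) simp_all
  also have "\<dots> = ?A $$ (Suc m, m) * cofactor ?A (Suc m) m + ?A $$ (Suc m, Suc m) * cofactor ?A (Suc m) (Suc m)"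
    by (simp add: tridiagonal_def)
  also have "\<dots> = d (Suc m) * det (?T (Suc m)) - (e m)\<^sup>2 * det (?T m)"
    by (simp add: cofactor_def D1 detN) (simp add: tridiagonal_def power2_eq_square)
  finally show ?thesis .
qed

section \<open>The characteristic polynomial of a CMV matrix\<close>

definition verblunsky_rho :: "(nat \<Rightarrow> complex) \<Rightarrow> nat \<Rightarrow> complex" where
  "verblunsky_rho \<alpha> i = complex_of_real (sqrt (1 - (cmod (\<alpha> i))\<^sup>2))"

text \<open>
  The coefficient \<open>\<alpha>\<^sub>i\<^sub>-\<^sub>1\<close>, with
  \<open>\<alpha>\<^sub>-\<^sub>1 = -1\<close>. This value makes the leading block \<open>[1]\<close>
  of \<open>cmv_M\<close> the lower right corner of a block of the general form.
\<close>

definition verblunsky_before :: "(nat \<Rightarrow> complex) \<Rightarrow> nat \<Rightarrow> complex" where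
  "verblunsky_before \<alpha> i = (case i of 0 \<Rightarrow> -1 | Suc k \<Rightarrow> \<alpha> k)"

text \<open>
  Entries of the block-diagonal matrix whose blocks start at the rows \<open>i\<close> with \<open>i +
  p\<close> even: \<open>p = 0\<close> yields \<open>cmv_L\<close> and \<open>p = 1\<close> yields
  \<open>cmv_M\<close>.
\<close>

definition theta_entry :: "nat \<Rightarrow> (nat \<Rightarrow> complex) \<Rightarrow> nat \<Rightarrow> nat \<Rightarrow> complex" where
  "theta_entry p \<alpha> i j =
    (if i = j then if even (i + p) then cnj (\<alpha> i) else - verblunsky_before \<alpha> i
     else if j = Suc i \<and> even (i + p) then verblunsky_rho \<alpha> i
     else if i = Suc j \<and> even (j + p) then verblunsky_rho \<alpha> j
     else 0)"

lemma cmv_block_entry: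
  assumes "i < dim_row (cmv_block n \<alpha> k)" "j < dim_row (cmv_block n \<alpha> k)" "even (k + p)"
  shows "cmv_block n \<alpha> k $$ (i, j) = theta_entry p \<alpha> (k + i) (k + j)"
proof (cases "Suc k = n")
  case True
  then show ?thesis
    using assms by (simp add: dim_cmv_block) (simp add: cmv_block_def mat_of_rows_list_def theta_entry_def)
next
  case False
  then have "i < 2" "j < 2" using assms by (simp_all add: dim_cmv_block)
  then have "i = 0 \<or> i = 1" "j = 0 \<or> j = 1" by auto
  then show ?thesis
    using assms(3) False
    by (auto simp: cmv_block_def mat_of_rows_list_def theta_entry_def verblunsky_before_def verblunsky_rho_def Let_def)
qed

text \<open>
  Peeling off the first block, which occupies the rows \<open>k\<close> and \<open>k + 1\<close>, or
  only the row \<open>k\<close> at the end.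
\<close>

lemma diag_block_cmv_entry:
  fixes n :: nat and \<alpha> :: "nat \<Rightarrow> complex"
  assumes "even (k + p)"
  defines "D \<equiv> (\<lambda>k. diag_block_mat (map (cmv_block n \<alpha>) (filter (\<lambda>j. even (j + p)) [k..<n])))"
  shows "dim_row (D k) = n - k \<and> dim_col (D k) = n - k \<and>
    (\<forall>i<n - k. \<forall>j<n - k. D k $$ (i, j) = theta_entry p \<alpha> (k + i) (k + j))"
  using assms(1)
proof (induction "n - k" arbitrary: k rule: less_induct)
  case less
  show ?case
  proof (cases "k < n")
    case False
    then show ?thesis by (simp add: D_def)
  next
    case True
    have odd: "\<not> even (Suc k + p)" using less.prems by simp
    have "[k..<n] = k # [Suc k..<n]" using True by (rule upt_conv_Cons)
    moreover have "filter (\<lambda>j. even (j + p)) [Suc k..<n] = filter (\<lambda>j. even (j + p)) [Suc (Suc k)..<n]"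
    proof (cases "Suc k < n")
      case True
      then have "[Suc k..<n] = Suc k # [Suc (Suc k)..<n]" by (rule upt_conv_Cons)
      then show ?thesis using odd by simp
    qed simp
    ultimately have list: "filter (\<lambda>j. even (j + p)) [k..<n] = k # filter (\<lambda>j. even (j + p)) [k + 2..<n]"
      using less.prems by simp
    let ?B = "cmv_block n \<alpha> k"
    have Dk: "D k = four_block_mat ?B (0\<^sub>m (dim_row ?B) (dim_col (D (k + 2)))) (0\<^sub>m (dim_row (D (k + 2))) (dim_col ?B)) (D (k + 2))"
      unfolding D_def list by (simp add: Let_def)
    have IH: "dim_row (D (k + 2)) = n - (k + 2)" "dim_col (D (k + 2)) = n - (k + 2)"
      "\<And>i j. i < n - (k + 2) \<Longrightarrow> j < n - (k + 2) \<Longrightarrow> D (k + 2) $$ (i, j) = theta_entry p \<alpha> (k + 2 + i) (k + 2 + j)"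
      using less.hyps[of "k + 2"] True less.prems by auto
    have dimB: "dim_row ?B = (if Suc k = n then 1 else 2)" "dim_col ?B = (if Suc k = n then 1 else 2)"
      by (rule dim_cmv_block)+
    have dim: "dim_row (D k) = n - k" "dim_col (D k) = n - k"
      unfolding Dk using IH(1,2) dimB True by (auto split: if_splits)
    moreover have "D k $$ (i, j) = theta_entry p \<alpha> (k + i) (k + j)" if ij: "i < n - k" "j < n - k" for i j
    proof -
      have sum: "dim_row ?B + (n - (k + 2)) = n - k" using dimB True by auto
      have "D k $$ (i, j) = (if i < dim_row ?B then if j < dim_row ?B then ?B $$ (i, j) else 0
          else if j < dim_row ?B then 0 else D (k + 2) $$ (i - dim_row ?B, j - dim_row ?B))"
        unfolding Dk using ij IH(1,2) dimB sum by (subst index_mat_four_block) auto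
      also have "\<dots> = theta_entry p \<alpha> (k + i) (k + j)"
      proof (cases "i < dim_row ?B \<and> j < dim_row ?B")
        case True
        then show ?thesis using cmv_block_entry less.prems by simp
      next
        case False
        then have B2: "dim_row ?B = 2"
          using dimB ij by (auto split: if_splits)
        show ?thesis
        proof (cases "i \<ge> 2 \<and> j \<ge> 2")
          case True
          then have "D (k + 2) $$ (i - 2, j - 2) = theta_entry p \<alpha> (k + 2 + (i - 2)) (k + 2 + (j - 2))"
            using ij by (intro IH(3)) auto
          moreover have "k + 2 + (i - 2) = k + i" "k + 2 + (j - 2) = k + j" using True by auto
          ultimately show ?thesis using True B2 by simp
        next
          case F: False
          have "theta_entry p \<alpha> (k + i) (k + j) = 0"
          proof -
            have "(i < 2 \<and> j \<ge> 2) \<or> (i \<ge> 2 \<and> j < 2)" using F False B2 by auto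
            moreover have "\<not> even (k + 1 + p)" using odd by simp
            ultimately show ?thesis
              unfolding theta_entry_def by (auto simp: less_2_cases_iff)
          qed
          then show ?thesis using F False B2 by auto
        qed
      qed
      finally show ?thesis .
    qed
    ultimately show ?thesis by blast
  qed
qed

definition theta_mat :: "nat \<Rightarrow> nat \<Rightarrow> (nat \<Rightarrow> complex) \<Rightarrow> complex mat" where
  "theta_mat n p \<alpha> = mat n n (\<lambda>(i, j). theta_entry p \<alpha> i j)"

lemma theta_mat_carrier [simp]: "theta_mat n p \<alpha> \<in> carrier_mat n n"
  by (simp add: theta_mat_def)

lemma cmv_L_eq: "cmv_L n \<alpha> = theta_mat n 0 \<alpha>"
  using diag_block_cmv_entry[of 0 0 n \<alpha>]
  by (intro eq_matI) (auto simp: cmv_L_def theta_mat_def)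

lemma cmv_M_eq:
  assumes "n \<ge> 1"
  shows "cmv_M n \<alpha> = theta_mat n 1 \<alpha>"
proof -
  let ?D = "diag_block_mat (map (cmv_block n \<alpha>) (filter (\<lambda>j. even (j + 1)) [1..<n]))"
  have list: "filter odd [0..<n] = filter (\<lambda>j. even (j + 1)) [1..<n]"
    using assms by (simp add: upt_conv_Cons)
  have D: "dim_row ?D = n - 1" "dim_col ?D = n - 1"
    "\<And>i j. i < n - 1 \<Longrightarrow> j < n - 1 \<Longrightarrow> ?D $$ (i, j) = theta_entry 1 \<alpha> (1 + i) (1 + j)"
    using diag_block_cmv_entry[of 1 1 n \<alpha>] by auto
  have M: "cmv_M n \<alpha> = four_block_mat (1\<^sub>m 1) (0\<^sub>m 1 (n - 1)) (0\<^sub>m (n - 1) 1) ?D"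
    unfolding cmv_M_def list diag_block_mat.simps Let_def D by simp
  show ?thesis
  proof (rule eq_matI)
    fix i j assume "i < dim_row (theta_mat n 1 \<alpha>)" "j < dim_col (theta_mat n 1 \<alpha>)"
    then have ij: "i < n" "j < n" by (simp_all add: theta_mat_def)
    have "cmv_M n \<alpha> $$ (i, j) = (if i < 1 then if j < 1 then 1 else 0 else if j < 1 then 0 else ?D $$ (i - 1, j - 1))"
      unfolding M using ij D(1,2) by (subst index_mat_four_block) auto
    also have "\<dots> = theta_entry 1 \<alpha> i j"
    proof (cases i)
      case 0
      then show ?thesis by (cases j) (auto simp: theta_entry_def verblunsky_before_def)
    next
      case (Suc i')
      then show ?thesis
        using D(3)[of i' "j - 1"] ij by (cases j) (auto simp: theta_entry_def)
    qed
    finally show "cmv_M n \<alpha> $$ (i, j) = theta_mat n 1 \<alpha> $$ (i, j)"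
      using ij by (simp add: theta_mat_def)
  qed (unfold M index_mat_four_block D, use assms in \<open>simp_all add: theta_mat_def\<close>)
qed

definition theta_adj :: "nat \<Rightarrow> nat \<Rightarrow> (nat \<Rightarrow> complex) \<Rightarrow> complex mat" where
  "theta_adj n p \<alpha> = mat n n (\<lambda>(i, j). cnj (theta_entry p \<alpha> i j))"

lemma verblunsky_rho_square:
  assumes "cmod (\<alpha> i) < 1"
  shows "verblunsky_rho \<alpha> i * verblunsky_rho \<alpha> i = 1 - \<alpha> i * cnj (\<alpha> i)"
proof -
  have "1 - (cmod (\<alpha> i))\<^sup>2 \<ge> 0" using assms by (simp add: power_le_one)
  then have "verblunsky_rho \<alpha> i * verblunsky_rho \<alpha> i = complex_of_real (1 - (cmod (\<alpha> i))\<^sup>2)"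
    by (simp add: verblunsky_rho_def flip: of_real_mult)
  then show ?thesis unfolding of_real_diff complex_norm_square by simp
qed

lemma cnj_verblunsky_rho [simp]: "cnj (verblunsky_rho \<alpha> i) = verblunsky_rho \<alpha> i"
  by (simp add: verblunsky_rho_def)

text \<open>
  For \<open>n + q\<close> even, this factor contains no truncated block, and each full block is
  unitary.
\<close>

lemma theta_unitary:
  assumes q: "even (n + q)" and \<alpha>: "\<And>k. k < n \<Longrightarrow> cmod (\<alpha> k) < 1"
  shows "theta_mat n q \<alpha> * theta_adj n q \<alpha> = 1\<^sub>m n"
proof (rule eq_matI)
  fix i j assume "i < dim_row (1\<^sub>m n :: complex mat)" "j < dim_col (1\<^sub>m n :: complex mat)"
  then have ij: "i < n" "j < n" by auto
  let ?t = "theta_entry q \<alpha>"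
  have "(theta_mat n q \<alpha> * theta_adj n q \<alpha>) $$ (i, j) = (\<Sum>k<n. ?t i k * cnj (?t k j))"
    using ij by (simp add: theta_mat_def theta_adj_def scalar_prod_def atLeast0LessThan)
  also have "\<dots> = (if i = j then 1 else 0)"
  proof (cases "even (i + q)")
    case True
    then have "Suc i \<noteq> n" using q by auto
    then have Si: "Suc i < n" using ij by simp
    have "(\<Sum>k<n. ?t i k * cnj (?t k j)) = (\<Sum>k\<in>{i, Suc i}. ?t i k * cnj (?t k j))"
      using ij Si True by (intro sum.mono_neutral_right) (auto simp: theta_entry_def)
    also have "\<dots> = (if i = j then 1 else 0)"
      using True verblunsky_rho_square[of \<alpha> i, OF \<alpha>[OF ij(1)]]
      by (auto simp: theta_entry_def verblunsky_before_def mult.commute)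
    finally show ?thesis .
  next
    case False
    show ?thesis
    proof (cases i)
      case 0
      have "(\<Sum>k<n. ?t i k * cnj (?t k j)) = (\<Sum>k\<in>{0}. ?t i k * cnj (?t k j))"
        using ij 0 False by (intro sum.mono_neutral_right) (auto simp: theta_entry_def)
      then show ?thesis
        using False 0 by (auto simp: theta_entry_def verblunsky_before_def)
    next
      case (Suc l)
      have l: "even (l + q)" using False Suc by simp
      have "(\<Sum>k<n. ?t i k * cnj (?t k j)) = (\<Sum>k\<in>{l, Suc l}. ?t i k * cnj (?t k j))"
        using ij Suc False by (intro sum.mono_neutral_right) (auto simp: theta_entry_def)
      then show ?thesis
        using l verblunsky_rho_square[of \<alpha> l] \<alpha>[of l] ij Suc
        by (auto simp: theta_entry_def verblunsky_before_def mult.commute)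
    qed
  qed
  also have "\<dots> = 1\<^sub>m n $$ (i, j)" using ij by simp
  finally show "(theta_mat n q \<alpha> * theta_adj n q \<alpha>) $$ (i, j) = 1\<^sub>m n $$ (i, j)" .
qed (simp_all add: theta_mat_def theta_adj_def)

lemma szego_relations:
  fixes \<alpha> :: "nat \<Rightarrow> complex"
  defines "P \<equiv> (\<lambda>m z. poly (szego \<alpha> m) z)" and "S \<equiv> (\<lambda>m z. poly (star_poly (szego \<alpha> m)) z)"
  shows "P (Suc m) z = z * P m z - cnj (\<alpha> m) * S m z" "S (Suc m) z = S m z - \<alpha> m * z * P m z"
  by (simp add: P_def S_def szego_step_def) (simp add: P_def S_def star_szego_step[OF szego_monic])

text \<open>
  The leading principal minors are, up to sign, alternately \<open>\<Phi>\<^sub>m\<close> and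
  \<open>\<Phi>\<^sub>m\<^sup>*\<close>: the three-term recursion of the minors is the Szego recursion
  after elimination of one of the two polynomials by means of \<open>\<rho>\<^sup>2
  \<Phi>\<^sub>l\<^sup>* = \<Phi>\<^sub>l\<^sub>+\<^sub>1\<^sup>* + \<alpha>\<^sub>l
  \<Phi>\<^sub>l\<^sub>+\<^sub>1\<close> or \<open>z \<rho>\<^sup>2 \<Phi>\<^sub>l =
  \<Phi>\<^sub>l\<^sub>+\<^sub>1 + cnj \<alpha>\<^sub>l
  \<Phi>\<^sub>l\<^sub>+\<^sub>1\<^sup>*\<close>.
\<close>

lemma det_cmv_tridiagonal:
  fixes \<alpha> :: "nat \<Rightarrow> complex" and q :: nat and z :: complex
  defines "d \<equiv> (\<lambda>i. if even (i + q) then z * \<alpha> i + verblunsky_before \<alpha> i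
                    else - z * cnj (verblunsky_before \<alpha> i) - cnj (\<alpha> i))"
    and "e \<equiv> (\<lambda>i. if even (i + q) then z * verblunsky_rho \<alpha> i else - verblunsky_rho \<alpha> i)"
    and "s \<equiv> (\<lambda>m. (\<Prod>i<m. if even (i + q) then - 1 else 1 :: complex))"
  assumes \<alpha>: "\<And>k. k < n \<Longrightarrow> cmod (\<alpha> k) < 1" and m: "m \<le> n"
  shows "det (tridiagonal m d e) = s m * (if even (m + q) then poly (szego \<alpha> m) z else poly (star_poly (szego \<alpha> m)) z)"
  using m
proof (induction m rule: less_induct)
  case (less m)
  let ?K = "\<lambda>m. det (tridiagonal m d e)"
  let ?P = "\<lambda>m. poly (szego \<alpha> m) z" and ?S = "\<lambda>m. poly (star_poly (szego \<alpha> m)) z"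
  consider "m = 0" | "m = 1" | l where "m = Suc (Suc l)"
    by (metis One_nat_def not0_implies_Suc)
  then show ?case
  proof cases
    case 1
    have "?K 0 = 1" by (rule det_dim_zero) simp
    then show ?thesis using 1 by (simp add: s_def star_poly_1)
  next
    case 2
    have "tridiagonal 1 d e = mat 1 1 (\<lambda>_. d 0)"
      by (rule eq_matI) (auto simp: tridiagonal_def)
    then have "?K 1 = d 0" by (simp add: det_single)
    then show ?thesis
      using 2 szego_relations[of \<alpha> 0 z] by (simp add: s_def d_def verblunsky_before_def star_poly_1)
  next
    case 3
    then have l: "Suc l \<le> n" "l \<le> n" "l < n" using less.prems by auto
    define a where "a = \<alpha> l"
    define b where "b = \<alpha> (Suc l)"
    define r where "r = verblunsky_rho \<alpha> l"
    have r: "r * r = 1 - a * cnj a"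
      unfolding r_def a_def by (rule verblunsky_rho_square[of \<alpha> l, OF \<alpha>[OF l(3)]])
    have IH1: "?K (Suc l) = s (Suc l) * (if even (Suc l + q) then ?P (Suc l) else ?S (Suc l))"
      using less.IH[of "Suc l"] 3 l by simp
    have IH0: "?K l = s l * (if even (l + q) then ?P l else ?S l)"
      using less.IH[of l] 3 l by simp
    have rec: "?K m = d (Suc l) * ?K (Suc l) - (e l)\<^sup>2 * ?K l"
      unfolding 3 by (rule det_tridiagonal_Suc_Suc)
    have rel: "?P (Suc l) = z * ?P l - cnj a * ?S l" "?S (Suc l) = ?S l - a * z * ?P l"
      "?P m = z * ?P (Suc l) - cnj b * ?S (Suc l)" "?S m = ?S (Suc l) - b * z * ?P (Suc l)"
      unfolding 3 a_def b_def by (rule szego_relations)+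
    show ?thesis
    proof (cases "even (l + q)")
      case True
      have s: "s (Suc l) = - s l" "s m = - s l" using True 3 by (simp_all add: s_def)
      have de: "d (Suc l) = - z * cnj a - cnj b" "e l = z * r"
        using True by (simp_all add: d_def e_def a_def b_def r_def verblunsky_before_def)
      have "?K m = - s l * ((- z * cnj a - cnj b) * ?S (Suc l) + z * (r * r) * z * ?P l)"
        unfolding rec IH1 IH0 de s using True by (simp add: power2_eq_square algebra_simps)
      also have "z * (r * r) * z * ?P l = z * (?P (Suc l) + cnj a * ?S (Suc l))"
        unfolding r rel(1,2) by (simp add: algebra_simps)
      finally show ?thesis
        using True 3 unfolding s rel(3) by (simp add: algebra_simps)
    next
      case False
      have s: "s (Suc l) = s l" "s m = - s l" using False 3 by (simp_all add: s_def)
      have de: "d (Suc l) = z * b + a" "e l = - r"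
        using False by (simp_all add: d_def e_def a_def b_def r_def verblunsky_before_def)
      have "?K m = s l * ((z * b + a) * ?P (Suc l) - (r * r) * ?S l)"
        unfolding rec IH1 IH0 de s using False by (simp add: power2_eq_square algebra_simps)
      also have "(r * r) * ?S l = ?S (Suc l) + a * ?P (Suc l)"
        unfolding r rel(1,2) by (simp add: algebra_simps)
      finally show ?thesis
        using False 3 unfolding s rel(4) by (simp add: algebra_simps)
    qed
  qed
qed

text \<open>
  One of the two factors, \<open>A\<close>, is unitary, because the truncated block sits in the other
  one, \<open>B\<close>. Pulling \<open>A\<close> out of \<open>z - A B\<close> or \<open>z - B
  A\<close> leaves the tridiagonal matrix \<open>z A\<^sup>* - B\<close>. The remaining constant is
  \<open>1\<close> because both polynomials are monic.
\<close>

lemma char_poly_cmv_matrix: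
  assumes n: "n \<ge> 1" and \<alpha>: "\<And>k. k < n \<Longrightarrow> cmod (\<alpha> k) < 1"
  shows "char_poly (cmv_matrix n \<alpha>) = szego \<alpha> n"
proof -
  \<comment> \<open>The block with index \<open>n - 1\<close> belongs to the factor with parity \<open>1 - q\<close>.\<close>
  define q where "q = n mod 2"
  have q: "even (n + q)" "q = 0 \<or> q = 1" by (auto simp: q_def)
  define A where "A = theta_mat n q \<alpha>"
  define A' where "A' = theta_adj n q \<alpha>"
  define B where "B = theta_mat n (1 - q) \<alpha>"
  define C where "C = cmv_matrix n \<alpha>"
  have carr: "A \<in> carrier_mat n n" "A' \<in> carrier_mat n n" "B \<in> carrier_mat n n" "C \<in> carrier_mat n n"
    using cmv_matrix_carrier[OF n] by (simp_all add: A_def A'_def B_def C_def theta_adj_def)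
  have AA': "A * A' = 1\<^sub>m n" unfolding A_def A'_def by (rule theta_unitary[OF q(1) \<alpha>])
  have A'A: "A' * A = 1\<^sub>m n" by (rule mat_mult_left_right_inverse[OF carr(1,2) AA'])
  have C: "C = (if q = 0 then A * B else B * A)"
    using q(2) n by (auto simp: C_def cmv_matrix_def cmv_L_eq cmv_M_eq A_def B_def)
  define s where "s = (\<Prod>i<n. if even (i + q) then - 1 else 1 :: complex)"
  have ev: "poly (char_poly C) z = det A * s * poly (szego \<alpha> n) z" for z
  proof -
    define T where "T = z \<cdot>\<^sub>m A' - B"
    have T: "T \<in> carrier_mat n n" unfolding T_def by (rule minus_carrier_mat[OF carr(3)])
    have "- (char_matrix C z) = (if q = 0 then A * T else T * A)"
    proof (cases "q = 0")
      case True
      have "A * T = z \<cdot>\<^sub>m (A * A') - A * B"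
        unfolding T_def mult_minus_distrib_mat[OF carr(1) smult_carrier_mat[OF carr(2)] carr(3)]
          mult_smult_distrib[OF carr(1,2)] ..
      also have "\<dots> = - (char_matrix C z)"
        unfolding AA' C using True carr by (intro eq_matI) (auto simp: char_matrix_def)
      finally show ?thesis using True by simp
    next
      case False
      have "T * A = z \<cdot>\<^sub>m (A' * A) - B * A"
        unfolding T_def minus_mult_distrib_mat[OF smult_carrier_mat[OF carr(2)] carr(3,1)]
          mult_smult_assoc_mat[OF carr(2,1)] ..
      also have "\<dots> = - (char_matrix C z)"
        unfolding A'A C using False carr by (intro eq_matI) (auto simp: char_matrix_def)
      finally show ?thesis using False by simp
    qed
    then have "poly (char_poly C) z = det A * det T"
      unfolding char_poly_matrix[OF carr(4)] using carr T by (simp add: det_mult)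
    also have "T = tridiagonal n (\<lambda>i. if even (i + q) then z * \<alpha> i + verblunsky_before \<alpha> i
                    else - z * cnj (verblunsky_before \<alpha> i) - cnj (\<alpha> i))
       (\<lambda>i. if even (i + q) then z * verblunsky_rho \<alpha> i else - verblunsky_rho \<alpha> i)"
      using q(2)
      by (intro eq_matI) (auto simp: T_def A'_def B_def theta_adj_def theta_mat_def tridiagonal_def theta_entry_def)
    also have "det \<dots> = s * poly (szego \<alpha> n) z"
      using det_cmv_tridiagonal[OF \<alpha>, where m = n and q = q and z = z] q(1) by (simp add: s_def)
    finally show ?thesis by simp
  qed
  then have "char_poly C = Polynomial.smult (det A * s) (szego \<alpha> n)"
    by (simp add: poly_eq_poly_eq_iff[symmetric] fun_eq_iff)
  moreover have "coeff (char_poly C) n = 1" using degree_monic_char_poly[OF carr(4)] by simp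
  ultimately show ?thesis
    using szego_monic(2)[of \<alpha> n] by (simp add: C_def)
qed

section \<open>The joint law of the eigenvalues\<close>

lemma measurable_poly_char_poly:
  assumes A: "\<And>x. A x \<in> carrier_mat n n"
    and entries: "\<And>i j. i < n \<Longrightarrow> j < n \<Longrightarrow> (\<lambda>x. A x $$ (i, j)) \<in> borel_measurable M"
  shows "measurable_poly M (\<lambda>x. char_poly (A x))"
proof -
  have 1: "char_poly (A x) = (\<Sum>p\<in>{p. p permutes {0..<n}}. signof p *
      (\<Prod>i = 0..<n. (if i = p i then [:0, 1:] else 0) + [:- A x $$ (i, p i):]))" for x
  proof -
    have "char_poly_matrix (A x) \<in> carrier_mat n n" using A by simp
    then have "char_poly (A x) = (\<Sum>p\<in>{p. p permutes {0..<n}}. signof p *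
        (\<Prod>i = 0..<n. char_poly_matrix (A x) $$ (i, p i)))"
      unfolding char_poly_def by (rule det_def')
    also have "\<dots> = (\<Sum>p\<in>{p. p permutes {0..<n}}. signof p *
      (\<Prod>i = 0..<n. (if i = p i then [:0, 1:] else 0) + [:- A x $$ (i, p i):]))"
    proof (intro sum.cong arg_cong2[where f = "(*)"] prod.cong refl)
      fix p i assume p: "p \<in> {p. p permutes {0..<n}}" and i: "i \<in> {0..<n}"
      then have "p i < n" using permutes_in_image[of p "{0..<n}" i] by auto
      then show "char_poly_matrix (A x) $$ (i, p i) = (if i = p i then [:0, 1:] else 0) + [:- A x $$ (i, p i):]"
        using i A[of x] by (auto simp: char_poly_matrix_def)
    qed
    finally show ?thesis .
  qed
  show ?thesis
    unfolding 1
  proof (intro measurable_poly_sum measurable_poly_mult measurable_poly_prod measurable_poly_add measurable_poly_const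
      measurable_poly_pCons)
    fix p i assume "p \<in> {p. p permutes {0..<n}}" "i \<in> {0..<n}"
    then have "p i < n" "i < n" using permutes_in_image[of p "{0..<n}" i] by auto
    then show "(\<lambda>x. - A x $$ (i, p i)) \<in> borel_measurable M"
      using entries by (intro borel_measurable_uminus) auto
  qed
qed

lemma borel_measurable_cmv_entry:
  assumes n: "n \<ge> 1" and \<alpha>: "\<And>k. k < n \<Longrightarrow> (\<lambda>x. \<alpha> x k) \<in> borel_measurable M" and ij: "i < n" "j < n"
  shows "(\<lambda>x. cmv_matrix n (\<alpha> x) $$ (i, j)) \<in> borel_measurable M"
proof -
  have rho: "(\<lambda>x. verblunsky_rho (\<alpha> x) k) \<in> borel_measurable M" if "k < n" for k
  proof -
    note [measurable] = \<alpha>[OF that]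
    show ?thesis unfolding verblunsky_rho_def by measurable
  qed
  have pred: "(\<lambda>x. verblunsky_before (\<alpha> x) k) \<in> borel_measurable M" if "k < n" for k
    using \<alpha> that by (cases k) (auto simp: verblunsky_before_def)
  have entry: "(\<lambda>x. theta_entry p (\<alpha> x) i j) \<in> borel_measurable M" if "i < n" "j < n" for p i j
    unfolding theta_entry_def using that rho pred measurable_compose[OF \<alpha> borel_measurable_cnj] by auto
  have "(\<lambda>x. \<Sum>k<n. theta_entry 0 (\<alpha> x) i k * theta_entry 1 (\<alpha> x) k j) \<in> borel_measurable M"
    using ij by (intro borel_measurable_sum borel_measurable_times entry) auto
  also have "(\<lambda>x. \<Sum>k<n. theta_entry 0 (\<alpha> x) i k * theta_entry 1 (\<alpha> x) k j) = (\<lambda>x. cmv_matrix n (\<alpha> x) $$ (i, j))"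
    unfolding cmv_matrix_def cmv_L_eq cmv_M_eq[OF n] using ij
    by (simp add: theta_mat_def scalar_prod_def atLeast0LessThan)
  finally show ?thesis .
qed

text \<open>
  This has to hold for all sample points, also for those where some
  \<open>\<bar>\<alpha>\<^sub>k\<bar> \<ge> 1\<close> and the Szego recursion says nothing; therefore
  it is derived from the entries of the matrix.
\<close>

lemma measurable_eigenvalue_mset_cmv:
  assumes n: "n \<ge> 1" and \<alpha>: "\<And>k. k < n \<Longrightarrow> (\<lambda>x. \<alpha> x k) \<in> borel_measurable M"
  shows "(\<lambda>x. eigenvalue_mset (cmv_matrix n (\<alpha> x))) \<in> measurable M (unordered_space n)"
  unfolding eigenvalue_mset_def
proof (rule measurable_monic[OF _ _ measurable_proots])
  show "measurable_poly M (\<lambda>x. char_poly (cmv_matrix n (\<alpha> x)))"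
    by (intro measurable_poly_char_poly[where n = n] cmv_matrix_carrier[OF n] n borel_measurable_cmv_entry \<alpha>)
  show "degree (char_poly (cmv_matrix n (\<alpha> x))) = n \<and> coeff (char_poly (cmv_matrix n (\<alpha> x))) n = 1" for x
    by (rule degree_monic_char_poly[OF cmv_matrix_carrier[OF n]])
qed

text \<open>
  The interaction is a nonnegative real number, hence equal to its modulus.
\<close>

lemma Re_interaction:
  assumes "\<And>j. j < n \<Longrightarrow> cmod (z j) < 1"
  shows "Re (interaction \<beta> n z) = (\<Prod>j<n. \<Prod>k<n. cmod (1 - z j * cnj (z k))) powr (\<beta> / 2 - 1)"
proof -
  have "Re (interaction \<beta> n z) = cmod (interaction \<beta> n z)"
    using assms by (intro nonneg_Reals_cmod_eq_Re[symmetric] interaction_nonneg_real) auto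
  also have "\<dots> = (\<Prod>j<n. \<Prod>k<n. cmod (1 - z j * cnj (z k)) powr (\<beta> / 2 - 1))"
    unfolding interaction_def prod_norm[symmetric] by (subst norm_powr_real_powr') auto
  finally show ?thesis unfolding prod_powr_distrib .
qed

lemma eigenvalue_density_eq:
  assumes z: "z \<in> space (lborel_pi n)"
  shows "eigenvalue_density \<beta> n z = ennreal (\<beta> ^ n / (2 * pi) ^ n) *
    (stable_weight (\<beta> / 2 - 1) (root_poly n z) * (\<Prod>k<n. \<Prod>j<k. ennreal ((cmod (z k - z j))\<^sup>2)))"
proof (cases "\<forall>j<n. cmod (z j) < 1")
  case True
  define P where "P = (\<Prod>j<n. \<Prod>k<n. cmod (1 - z j * cnj (z k))) powr (\<beta> / 2 - 1)"
  define D where "D = (\<Prod>k<n. \<Prod>j<k. (cmod (z k - z j))\<^sup>2)"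
  have "z \<in> PiE {..<n} (\<lambda>_. ball 0 1)" using True z by (auto simp: space_PiM PiE_iff)
  moreover have "Re (interaction \<beta> n z) = P"
    using True unfolding P_def by (intro Re_interaction) auto
  ultimately have "eigenvalue_density \<beta> n z = ennreal (\<beta> ^ n / (2 * pi) ^ n * (P * D))"
    by (simp add: eigenvalue_density_def D_def mult.assoc)
  also have "\<dots> = ennreal (\<beta> ^ n / (2 * pi) ^ n) * (ennreal P * ennreal D)"
    by (subst ennreal_mult'') (auto simp: P_def D_def ennreal_mult' intro!: mult_nonneg_nonneg prod_nonneg)
  also have "ennreal D = (\<Prod>k<n. \<Prod>j<k. ennreal ((cmod (z k - z j))\<^sup>2))"
    by (simp add: D_def prod_ennreal prod_nonneg)
  also have "ennreal P = stable_weight (\<beta> / 2 - 1) (root_poly n z)"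
    using True by (simp add: stable_weight_root_poly P_def)
  finally show ?thesis .
next
  case False
  then have "z \<notin> PiE {..<n} (\<lambda>_. ball 0 1)" by (auto simp: PiE_iff)
  then show ?thesis
    unfolding eigenvalue_density_def stable_weight_root_poly using False by auto
qed

lemma emeasure_eigenvalue_law:
  assumes A: "A \<in> sets (unordered_space n)"
  shows "emeasure (distr (density (lborel_pi n) (eigenvalue_density \<beta> n)) (unordered_space n) (unordered n)) A
    = ennreal (\<beta> ^ n / (2 * pi) ^ n) * (fact n *
      (\<integral>\<^sup>+c. indicator A (proots (monic_poly n c)) * stable_weight (\<beta> / 2 - 1) (monic_poly n c) \<partial>lborel_pi n))"
proof -
  define s where "s = \<beta> / 2 - 1"
  define K where "K = ennreal (\<beta> ^ n / (2 * pi) ^ n)"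
  define V where "V z = (\<Prod>k<n. \<Prod>j<k. ennreal ((cmod (z k - z j))\<^sup>2))" for z :: "nat \<Rightarrow> complex"
  define G where "G p = indicator A (proots p) * stable_weight s p" for p
  have ind: "(\<lambda>c. indicator A (proots (monic_poly n c)) :: ennreal) \<in> borel_measurable (lborel_pi n)"
    by (rule measurable_compose[OF measurable_proots borel_measurable_indicator[OF A]])
  have G: "(\<lambda>c. G (monic_poly n c)) \<in> borel_measurable (lborel_pi n)"
    unfolding G_def by (intro borel_measurable_times_ennreal ind measurable_stable_weight)
  have root_meas: "measurable_poly (lborel_pi n) (\<lambda>z. root_poly n z)"
    by (intro measurable_poly_prod measurable_poly_pCons measurable_poly_const borel_measurable_uminus measurable_coordinate) auto
  have V: "V \<in> borel_measurable (lborel_pi n)"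
    unfolding V_def
  proof (intro borel_measurable_prod_ennreal)
    fix k j assume "k \<in> {..<n}" "j \<in> {..<k}"
    then have [measurable]: "(\<lambda>z. z k) \<in> borel_measurable (lborel_pi n)" "(\<lambda>z. z j) \<in> borel_measurable (lborel_pi n)"
      using measurable_coordinate by auto
    show "(\<lambda>z. ennreal ((cmod (z k - z j))\<^sup>2)) \<in> borel_measurable (lborel_pi n)" by measurable
  qed
  have WV: "(\<lambda>z. stable_weight s (root_poly n z) * V z) \<in> borel_measurable (lborel_pi n)"
    by (intro borel_measurable_times_ennreal V measurable_monic[OF root_meas _ measurable_stable_weight[of s n]])
       (simp add: root_poly_monic)
  have GV: "(\<lambda>z. G (root_poly n z) * V z) \<in> borel_measurable (lborel_pi n)"
    by (intro borel_measurable_times_ennreal V measurable_monic[OF root_meas _ G])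
       (simp add: root_poly_monic)
  have Kmeas: "(\<lambda>z. K * (stable_weight s (root_poly n z) * V z)) \<in> borel_measurable (lborel_pi n)"
    by (intro borel_measurable_times_ennreal WV) simp
  have dens: "density (lborel_pi n) (eigenvalue_density \<beta> n) = density (lborel_pi n) (\<lambda>z. K * (stable_weight s (root_poly n z) * V z))"
  proof -
    have eq: "eigenvalue_density \<beta> n z = K * (stable_weight s (root_poly n z) * V z)" if "z \<in> space (lborel_pi n)" for z
      unfolding K_def s_def V_def by (rule eigenvalue_density_eq[OF that])
    have "eigenvalue_density \<beta> n \<in> borel_measurable (lborel_pi n)"
      using Kmeas by (subst measurable_cong[OF eq]) auto
    then show ?thesis using Kmeas eq by (intro density_cong) auto
  qed
  have U: "unordered n -` A \<inter> space (lborel_pi n) \<in> sets (lborel_pi n)"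
    using measurable_sets[OF measurable_unordered A] .
  have "emeasure (distr (density (lborel_pi n) (eigenvalue_density \<beta> n)) (unordered_space n) (unordered n)) A
      = emeasure (density (lborel_pi n) (\<lambda>z. K * (stable_weight s (root_poly n z) * V z))) (unordered n -` A \<inter> space (lborel_pi n))"
    unfolding dens using measurable_unordered[of n] A by (subst emeasure_distr) auto
  also have "\<dots> = (\<integral>\<^sup>+z. K * (stable_weight s (root_poly n z) * V z) * indicator (unordered n -` A \<inter> space (lborel_pi n)) z \<partial>lborel_pi n)"
    by (rule emeasure_density[OF Kmeas U])
  also have "\<dots> = (\<integral>\<^sup>+z. K * (G (root_poly n z) * V z) \<partial>lborel_pi n)"
    by (intro nn_integral_cong) (auto simp: G_def proots_root_poly unordered_def indicator_def)
  also have "\<dots> = K * (\<integral>\<^sup>+z. G (root_poly n z) * V z \<partial>lborel_pi n)"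
    by (rule nn_integral_cmult[OF GV])
  also have "(\<integral>\<^sup>+z. G (root_poly n z) * V z \<partial>lborel_pi n) = fact n * (\<integral>\<^sup>+c. G (monic_poly n c) \<partial>lborel_pi n)"
    unfolding V_def by (rule nn_integral_vieta[OF G])
  finally show ?thesis by (simp add: K_def G_def s_def)
qed

theorem theorem6p1:
  fixes \<beta> :: real and n :: nat
    and M :: "'w measure" and \<alpha> :: "nat \<Rightarrow> 'w \<Rightarrow> complex"
  assumes "0 < \<beta>" and "n \<ge> 1"
    and "prob_space M"
    and "prob_space.indep_vars M (\<lambda>_. borel) \<alpha> {..<n}"
    and "\<And>k. k < n \<Longrightarrow> distributed M lborel (\<alpha> k) (verblunsky_density \<beta> k)"
  shows "(\<lambda>w. eigenvalue_mset (cmv_matrix n (\<lambda>k. \<alpha> k w))) \<in> measurable M (unordered_space n)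
    \<and> distr M (unordered_space n) (\<lambda>w. eigenvalue_mset (cmv_matrix n (\<lambda>k. \<alpha> k w)))
      = distr (density (PiM {..<n} (\<lambda>_. lborel)) (eigenvalue_density \<beta> n))
              (unordered_space n) (unordered n)"
proof
  interpret prob_space M by fact
  define N where "N k = density lborel (verblunsky_density \<beta> k)" for k
  define X where "X w = eigenvalue_mset (cmv_matrix n (\<lambda>k. \<alpha> k w))" for w
  define s where "s = \<beta> / 2 - 1"
  have \<alpha>_meas: "\<alpha> k \<in> borel_measurable M" if "k < n" for k
    using distributed_measurable[OF assms(5)[OF that]] by simp
  have X_meas: "X \<in> measurable M (unordered_space n)"
    unfolding X_def by (rule measurable_eigenvalue_mset_cmv[OF assms(2)]) (use \<alpha>_meas in auto)
  then show "(\<lambda>w. eigenvalue_mset (cmv_matrix n (\<lambda>k. \<alpha> k w))) \<in> measurable M (unordered_space n)"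
    by (simp add: X_def[abs_def])
  have law: "distr M borel (\<alpha> k) = N k" if "k < n" for k
  proof -
    have "distr M borel (\<alpha> k) = distr M lborel (\<alpha> k)" by (intro distr_cong) auto
    then show ?thesis
      using distributed_distr_eq_density[OF assms(5)[OF that]] by (simp add: N_def)
  qed
  have disc: "AE w in M. cmod (\<alpha> k w) < 1" if "k < n" for k
  proof (rule AE_distrD[OF \<alpha>_meas[OF that]])
    show "AE a in distr M borel (\<alpha> k). cmod a < 1"
      unfolding law[OF that] N_def
      by (subst AE_density) (auto simp: verblunsky_density_def indicator_def)
  qed
  define R where "R w = (\<lambda>k\<in>{..<n}. \<alpha> k w)" for w
  have R_meas: "R \<in> measurable M (PiM {..<n} (\<lambda>_. borel))"
    unfolding R_def by (intro measurable_restrict \<alpha>_meas) auto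
  have joint: "distr M (PiM {..<n} (\<lambda>_. borel)) R = PiM {..<n} N"
  proof -
    have "distr M (PiM {..<n} (\<lambda>_. borel)) R = PiM {..<n} (\<lambda>k. distr M borel (\<alpha> k))"
      unfolding R_def using assms(2,4) \<alpha>_meas
      by (subst indep_vars_iff_distr_eq_PiM'[symmetric]) (auto simp: lessThan_empty_iff)
    also have "\<dots> = PiM {..<n} N" by (intro PiM_cong) (auto simp: law)
    finally show ?thesis .
  qed
  have X_eq: "AE w in M. X w = proots (szego (R w) n)"
  proof -
    have "AE w in M. \<forall>k\<in>{..<n}. cmod (\<alpha> k w) < 1"
      using disc by (intro AE_finite_allI) auto
    then show ?thesis
    proof eventually_elim
      case (elim w)
      then have "X w = proots (szego (\<lambda>k. \<alpha> k w) n)"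
        using char_poly_cmv_matrix[OF assms(2), of "\<lambda>k. \<alpha> k w"] by (simp add: X_def eigenvalue_mset_def)
      also have "szego (\<lambda>k. \<alpha> k w) n = szego (R w) n"
        by (rule szego_cong) (simp add: R_def)
      finally show ?case .
    qed
  qed
  show "distr M (unordered_space n) (\<lambda>w. eigenvalue_mset (cmv_matrix n (\<lambda>k. \<alpha> k w)))
      = distr (density (PiM {..<n} (\<lambda>_. lborel)) (eigenvalue_density \<beta> n)) (unordered_space n) (unordered n)"
  proof (rule measure_eqI)
    fix A assume "A \<in> sets (distr M (unordered_space n) (\<lambda>w. eigenvalue_mset (cmv_matrix n (\<lambda>k. \<alpha> k w))))"
    then have A: "A \<in> sets (unordered_space n)" by simp
    define G where "G p = (indicator A (proots p) :: ennreal)" for p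
    have G: "(\<lambda>c. G (monic_poly n c)) \<in> borel_measurable (lborel_pi n)"
      unfolding G_def by (rule measurable_compose[OF measurable_proots borel_measurable_indicator[OF A]])
    have szego_meas: "(\<lambda>\<alpha>. G (szego \<alpha> n)) \<in> borel_measurable (PiM {..<n} (\<lambda>_. borel))"
    proof (rule measurable_monic[OF measurable_poly_szego _ G])
      show "(\<lambda>x. x i) \<in> borel_measurable (PiM {..<n} (\<lambda>_. borel :: complex measure))" if "i < n" for i
        using measurable_component_singleton[of i "{..<n}" "\<lambda>_. borel"] that by simp
    qed (simp add: szego_monic)
    have "emeasure (distr M (unordered_space n) X) A = (\<integral>\<^sup>+w. indicator A (X w) \<partial>M)"
      using X_meas A by (simp add: nn_integral_indicator[symmetric] nn_integral_distr del: nn_integral_indicator)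
    also have "\<dots> = (\<integral>\<^sup>+w. G (szego (R w) n) \<partial>M)"
      using X_eq by (intro nn_integral_cong_AE) (auto simp: G_def)
    also have "\<dots> = (\<integral>\<^sup>+\<alpha>. G (szego \<alpha> n) \<partial>PiM {..<n} N)"
      unfolding joint[symmetric] using nn_integral_distr[OF R_meas, of "\<lambda>\<alpha>. G (szego \<alpha> n)"] szego_meas by simp
    also have "\<dots> = (\<Prod>k<n. ennreal (\<beta> * real (k + 1) / (2 * pi))) *
        (\<integral>\<^sup>+c. G (monic_poly n c) * stable_weight s (monic_poly n c) \<partial>lborel_pi n)"
      unfolding N_def s_def by (rule nn_integral_szego[OF G])
    also have "(\<Prod>k<n. ennreal (\<beta> * real (k + 1) / (2 * pi))) = ennreal (\<beta> ^ n / (2 * pi) ^ n) * fact n"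
    proof -
      have "(\<Prod>k<n. ennreal (\<beta> * real (k + 1) / (2 * pi))) = ennreal (\<Prod>k<n. \<beta> * real (k + 1) / (2 * pi))"
        using assms(1) by (intro prod_ennreal) auto
      also have "(\<Prod>k<n. \<beta> * real (k + 1) / (2 * pi)) = \<beta> ^ n / (2 * pi) ^ n * fact n"
        by (induction n) (auto simp: field_simps)
      also have "ennreal \<dots> = ennreal (\<beta> ^ n / (2 * pi) ^ n) * fact n"
      proof -
        have "ennreal (fact n) = fact n"
          by (metis ennreal_of_nat_eq_real_of_nat of_nat_fact)
        then show ?thesis using assms(1) by (subst ennreal_mult) simp_all
      qed
      finally show ?thesis .
    qed
    finally have "emeasure (distr M (unordered_space n) X) A
      = emeasure (distr (density (lborel_pi n) (eigenvalue_density \<beta> n)) (unordered_space n) (unordered n)) A"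
      unfolding emeasure_eigenvalue_law[OF A] by (simp only: G_def s_def mult.assoc)
    then show "emeasure (distr M (unordered_space n) (\<lambda>w. eigenvalue_mset (cmv_matrix n (\<lambda>k. \<alpha> k w)))) A
      = emeasure (distr (density (lborel_pi n) (eigenvalue_density \<beta> n)) (unordered_space n) (unordered n)) A"
      by (simp add: X_def[abs_def])
  qed simp
qed

end
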